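(* Let $\Omega \subset \mathbb{R}^{2}$ be a strictly convex, bounded open set with smooth boundary $\partial\Omega$, and let $g : \partial\Omega \to \mathbb{R}$ be a nonconstant continuous function whose level sets have finitely many endpoints. Then there is at least one continuous function $u : \overline{\Omega} \to \mathbb{R}$ that satisfies the local median value property in $\Omega$ and such that $u = g$ on $\partial\Omega$.
   Context: Notation: $B(x,r)$ is the ball (disc) in $\mathbb{R}^2$ with center $x$ and radius $r$, and $\partial B(x,r)$ is its boundary circle, equipped with arclength measure. Median: if $f$ is measurable with respect to $\mu$ and $E$ is a measurable set, $m \in \mathbb{R}$ is a median of $f$ over $E$ if and only if $\mu\{x\in E : f(x)\ge m\} \ge \mu(E)/2$ and $\mu\{x \in E : f(x)\le m\}\ge \mu(E)/2$. When $f$ is continuous on a circle $\partial B(x,r)$ (with arclength measure), the median is unique and is denoted $\operatorname{median}_{s\in\partial B(x,r)}\{f(s)\}$. Local median value property: a continuous function $u$ has the local median value property in $\Omega$ if there is a continuous function $R:\Omega\to\mathbb{R}$ with $0 < R(x) \le \operatorname{dist}(x,\partial\Omega)$ for all $x\in\Omega$ such that $$u(x) = \operatorname{median}_{s\in\partial B(x,r)}\{u(s)\}\quad\text{for all } x\in\Omega \text{ and } 0<r\le R(x).$$ Strictly convex means that for any two distinct points of $\overline\Omega$, the open line segment joining them lies in $\Omega$. The hypothesis that the level sets of $g$ have finitely many endpoints means: for each $\lambda\in\mathbb{R}$, the boundary of $g^{-1}(\lambda)$ relative to the curve $\partial\Omega$ is a finite set. *)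

theory Defs
  imports "HOL-Analysis.Analysis"
begin

definition is_median :: "'a measure \<Rightarrow> 'a set \<Rightarrow> ('a \<Rightarrow> real) \<Rightarrow> real \<Rightarrow> bool" where
  "is_median M E f m \<longleftrightarrow>
     emeasure M {x\<in>E. f x \<ge> m} \<ge> emeasure M E / 2 \<and>
     emeasure M {x\<in>E. f x \<le> m} \<ge> emeasure M E / 2"

definition circle_path :: "real^2 \<Rightarrow> real \<Rightarrow> real \<Rightarrow> real^2" where
  "circle_path x r t = x + r *\<^sub>R vector [cos (t / r), sin (t / r)]"

text \<open>
  For \<open>r > 0\<close>, \<open>circle_path x r\<close> runs through \<open>sphere x r\<close> with unit speed, exactly once
  on \<open>[0, 2 * pi * r)\<close>, so its image measure is arclength.
\<close>
definition arclength :: "real^2 \<Rightarrow> real \<Rightarrow> (real^2) measure" where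
  "arclength x r = distr (restrict_space lborel {0..<2 * pi * r}) borel (circle_path x r)"

text \<open>
  For continuous \<open>f\<close> and \<open>r > 0\<close> there is at most one such \<open>m\<close>, by
  \<open>is_median_sphere_unique\<close> below.
\<close>
definition circle_median :: "real^2 \<Rightarrow> real \<Rightarrow> (real^2 \<Rightarrow> real) \<Rightarrow> real" where
  "circle_median x r f = (THE m. is_median (arclength x r) (sphere x r) f m)"

text \<open>
  The circles may touch the boundary when \<open>r\<close> equals the distance to it, so \<open>u\<close> is a function
  whose values on \<open>closure \<Omega>\<close> matter.
\<close>
definition local_median_value_property :: "(real^2) set \<Rightarrow> (real^2 \<Rightarrow> real) \<Rightarrow> bool" where
  "local_median_value_property \<Omega> u \<longleftrightarrow>
     continuous_on \<Omega> u \<and>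
     (\<exists>R. continuous_on \<Omega> R \<and>
          (\<forall>x\<in>\<Omega>. 0 < R x \<and> R x \<le> infdist x (frontier \<Omega>)) \<and>
          (\<forall>x\<in>\<Omega>. \<forall>r. 0 < r \<and> r \<le> R x \<longrightarrow> u x = circle_median x r u))"

definition strictly_convex :: "(real^2) set \<Rightarrow> bool" where
  "strictly_convex \<Omega> \<longleftrightarrow>
     (\<forall>x\<in>closure \<Omega>. \<forall>y\<in>closure \<Omega>. x \<noteq> y \<longrightarrow> open_segment x y \<subseteq> \<Omega>)"

definition smooth_real :: "(real \<Rightarrow> real) \<Rightarrow> bool" where
  "smooth_real \<gamma> \<longleftrightarrow> (\<forall>n t. (deriv ^^ n) \<gamma> field_differentiable at t)"

text \<open>
  Near each boundary point, in suitable orthonormal coordinates \<open>(y \<bullet> a, y \<bullet> b)\<close>, the set is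
  the strict epigraph of a smooth function of one variable.
\<close>
definition smooth_boundary :: "(real^2) set \<Rightarrow> bool" where
  "smooth_boundary \<Omega> \<longleftrightarrow>
     (\<forall>p\<in>frontier \<Omega>. \<exists>\<rho>>0. \<exists>a b \<gamma>.
        norm a = 1 \<and> norm b = 1 \<and> a \<bullet> b = 0 \<and> smooth_real \<gamma> \<and>
        \<Omega> \<inter> ball p \<rho> = {y \<in> ball p \<rho>. y \<bullet> b > \<gamma> (y \<bullet> a)})"

lemma circle_path_in_sphere:
  assumes "r > 0"
  shows "circle_path x r t \<in> sphere x r"
proof -
  have "norm (vector [cos (t / r), sin (t / r)] :: real^2) = 1"
    by (simp add: norm_vec_def L2_set_def sum_2)
  then show ?thesis
    using assms by (simp add: circle_path_def dist_norm)
qed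

lemma continuous_on_circle_path: "continuous_on A (circle_path x r)"
proof -
  have eq: "circle_path x r = (\<lambda>t. \<chi> i. x $ i + r * (if i = 1 then cos (t * inverse r) else sin (t * inverse r)))"
    unfolding circle_path_def
    by (auto simp: fun_eq_iff vec_eq_iff forall_2 divide_inverse)
  show ?thesis
    unfolding eq
    by (intro continuous_on_vec_lambda continuous_on_add continuous_on_mult continuous_on_const)
       (rename_tac i, case_tac "i = 1", auto intro!: continuous_intros)
qed

lemma emeasure_arclength:
  assumes "X \<in> sets borel"
  shows "emeasure (arclength x r) X = emeasure lborel ({0..<2 * pi * r} \<inter> circle_path x r -` X)"
proof -
  have m: "circle_path x r \<in> borel_measurable borel"
    by (intro borel_measurable_continuous_onI continuous_on_circle_path)
  have m': "circle_path x r \<in> measurable (restrict_space lborel {0..<2 * pi * r}) borel"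
    using m by (simp add: measurable_restrict_space1)
  have "emeasure (arclength x r) X
      = emeasure (restrict_space lborel {0..<2 * pi * r}) (circle_path x r -` X \<inter> {0..<2 * pi * r})"
    unfolding arclength_def using assms m'
    by (simp add: emeasure_distr space_restrict_space)
  also have "\<dots> = emeasure lborel (circle_path x r -` X \<inter> {0..<2 * pi * r})"
    by (intro emeasure_restrict_space) auto
  finally show ?thesis
    by (simp add: Int_commute)
qed

lemma emeasure_arclength_sphere:
  assumes "r > 0"
  shows "emeasure (arclength x r) (sphere x r) = ennreal (2 * pi * r)"
proof -
  have "circle_path x r -` sphere x r = UNIV"
    using circle_path_in_sphere[OF assms, of x] by blast
  then show ?thesis
    using assms by (simp add: emeasure_arclength borel_closed)
qed

lemma is_median_sphere_unique:
  assumes r: "r > 0" and f: "continuous_on (sphere x r) f"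
    and m1: "is_median (arclength x r) (sphere x r) f m1"
    and m2: "is_median (arclength x r) (sphere x r) f m2"
  shows "m1 = m2"
proof -
  have False if less: "m1 < m2"
    and m1: "is_median (arclength x r) (sphere x r) f m1"
    and m2: "is_median (arclength x r) (sphere x r) f m2" for m1 m2
  proof -
    define h where "h = f \<circ> circle_path x r"
    define I where "I = {0..<2 * pi * r}"
    have inS: "circle_path x r t \<in> sphere x r" for t
      by (rule circle_path_in_sphere[OF r])
    have h: "continuous_on S h" for S
      unfolding h_def
      by (intro continuous_on_compose continuous_on_circle_path continuous_on_subset[OF f])
         (use inS in blast)
    have closedA: "closed {s \<in> sphere x r. f s \<le> m}" for m
      using continuous_closed_preimage[OF f, of "{..m}"] by (simp add: vimage_def Int_def)
    have closedB: "closed {s \<in> sphere x r. f s \<ge> m}" for m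
      using continuous_closed_preimage[OF f, of "{m..}"] by (simp add: vimage_def Int_def)
    define A where "A = {t \<in> I. h t \<le> m1}"
    define B where "B = {t \<in> I. h t \<ge> m2}"
    define C where "C = {t \<in> {0<..<2 * pi * r}. m1 < h t \<and> h t < m2}"
    have half: "ennreal (2 * pi * r) / 2 = ennreal (pi * r)"
      using r ennreal_divide_numeral[of "2 * pi * r" "num.Bit0 num.One"] by simp
    have "emeasure (arclength x r) {s \<in> sphere x r. f s \<le> m1} \<ge> ennreal (pi * r)"
      using m1 r half by (simp add: is_median_def emeasure_arclength_sphere)
    moreover have "{0..<2 * pi * r} \<inter> circle_path x r -` {s \<in> sphere x r. f s \<le> m1} = A"
      using inS by (auto simp: A_def I_def h_def)
    ultimately have eA: "emeasure lborel A \<ge> ennreal (pi * r)"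
      using emeasure_arclength[OF borel_closed[OF closedA[of m1]]] by simp
    have "emeasure (arclength x r) {s \<in> sphere x r. f s \<ge> m2} \<ge> ennreal (pi * r)"
      using m2 r half by (simp add: is_median_def emeasure_arclength_sphere)
    moreover have "{0..<2 * pi * r} \<inter> circle_path x r -` {s \<in> sphere x r. f s \<ge> m2} = B"
      using inS by (auto simp: B_def I_def h_def)
    ultimately have eB: "emeasure lborel B \<ge> ennreal (pi * r)"
      using emeasure_arclength[OF borel_closed[OF closedB[of m2]]] by simp
    have pos: "ennreal (pi * r) > 0"
      using r by simp
    have "A \<noteq> {}" "B \<noteq> {}"
      using eA eB pos by auto
    then obtain a b where ab: "a \<in> I" "h a \<le> m1" "b \<in> I" "h b \<ge> m2"
      by (auto simp: A_def B_def)
    define m where "m = (m1 + m2) / 2"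
    have m: "m1 < m" "m < m2"
      using less by (auto simp: m_def)
    have "is_interval (h ` closed_segment a b)"
      by (intro is_interval_connected_1[THEN iffD2] connected_continuous_image h) auto
    then have "m \<in> h ` closed_segment a b"
      by (rule mem_is_interval_1_I[of _ "h a" "h b"]) (use ab m in auto)
    then obtain t where t: "t \<in> closed_segment a b" "h t = m"
      by auto
    have "t \<noteq> a" "t \<noteq> b"
      using t ab m by auto
    then have "t \<in> open_segment a b"
      using t by (simp add: open_segment_def)
    then have "t \<in> C"
      using ab t m by (auto simp: C_def I_def open_segment_eq_real_ivl split: if_splits)
    have "open (h -` {m1<..<m2} \<inter> {0<..<2 * pi * r})"
      using continuous_open_vimage[of "{m1<..<m2}" h] h[of UNIV]
      by (intro open_Int) (auto simp: continuous_on_eq_continuous_at)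
    moreover have "h -` {m1<..<m2} \<inter> {0<..<2 * pi * r} = C"
      by (auto simp: C_def)
    ultimately have oC: "open C" by simp
    then have "\<not> negligible C"
      using \<open>t \<in> C\<close> open_not_negligible by blast
    then have eC: "emeasure lborel C > 0"
      using oC by (simp add: negligible_iff_emeasure0 zero_less_iff_neq_zero borel_open)
    have hm: "h \<in> borel_measurable borel"
      by (intro borel_measurable_continuous_onI h)
    have meas: "A \<in> sets lborel" "B \<in> sets lborel" "C \<in> sets lborel"
      using hm oC by (auto simp: A_def B_def I_def)
    have "ennreal (pi * r) + ennreal (pi * r) + emeasure lborel C
        \<le> emeasure lborel A + emeasure lborel B + emeasure lborel C"
      using eA eB by (intro add_mono) auto
    also have "emeasure lborel A + emeasure lborel B = emeasure lborel (A \<union> B)"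
      using meas less by (intro plus_emeasure) (auto simp: A_def B_def)
    also have "emeasure lborel (A \<union> B) + emeasure lborel C = emeasure lborel (A \<union> B \<union> C)"
      using meas by (intro plus_emeasure) (auto simp: A_def B_def C_def)
    also have "\<dots> \<le> emeasure lborel I"
      by (intro emeasure_mono) (auto simp: A_def B_def C_def I_def)
    also have "\<dots> = ennreal (pi * r) + ennreal (pi * r) + 0"
      using r by (simp add: I_def flip: ennreal_plus)
    finally have "emeasure lborel C \<le> 0"
      by (simp add: ennreal_add_left_cancel_le flip: ennreal_plus)
    with eC show False by simp
  qed
  with m1 m2 show ?thesis
    by (metis linorder_neqE)
qed

lemma circle_median_eqI:
  assumes "r > 0" "continuous_on (sphere x r) f"
    and "is_median (arclength x r) (sphere x r) f m"
  shows "circle_median x r f = m"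
  unfolding circle_median_def
  using assms is_median_sphere_unique by (intro the_equality) blast+

end

theory Submission
  imports Defs "HOL-Complex_Analysis.Great_Picard"
begin

text \<open>
  In place of a function of least gradient we use finite approximations to it. Rounding \<open>g\<close> to
  multiples of \<open>1/N\<close> leaves finitely many upward and downward jumps on \<open>\<partial>\<Omega>\<close>; pair the
  downward with the upward jumps by chords of minimal total length, and let \<open>u\<^sub>N\<close> be
  \<open>1/N\<close> times the number of half planes, one to the left of each chord, plus a constant. By
  minimality the chords are pairwise disjoint, so \<open>u\<^sub>N\<close> is constant along each of them and hence
  is controlled by \<open>g\<close>: near-by points of \<open>\<Omega>\<close> that are separated by chords lie near chords with
  near-by endpoints. Again by minimality, no two of these half planes can face each other near a point
  \<open>x\<close>, that is, within a tenth of its distance to \<open>\<partial>\<Omega>\<close> they are nested; so there both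
  \<open>u\<^sub>N \<ge> u\<^sub>N x\<close> and \<open>u\<^sub>N \<le> u\<^sub>N x\<close> hold on half discs around \<open>x\<close>. This
  property, which makes \<open>u x\<close> the median of \<open>u\<close> on circles, passes to limits of the \<open>u\<^sub>N\<close>.
\<close>

section \<open>Strictly convex planar domains\<close>

definition cross2 :: "real^2 \<Rightarrow> real^2 \<Rightarrow> real" where
  "cross2 a b = a$1 * b$2 - a$2 * b$1"

text \<open>Strictness excludes the line itself, so that a chord never meets its own side; for
  \<open>p = q\<close> the set is empty.\<close>

definition left_side :: "real^2 \<Rightarrow> real^2 \<Rightarrow> (real^2) set" where
  "left_side p q = {y. 0 < cross2 (q - p) (y - p)}"

lemma cross2_simps [simp]:
  "cross2 a a = 0" "cross2 0 a = 0" "cross2 a 0 = 0"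
  "cross2 (t *\<^sub>R a) b = t * cross2 a b" "cross2 a (t *\<^sub>R b) = t * cross2 a b"
  "cross2 (- a) b = - cross2 a b" "cross2 a (- b) = - cross2 a b"
  by (simp_all add: cross2_def algebra_simps)

lemma cross2_linear:
  "cross2 (a + b) c = cross2 a c + cross2 b c" "cross2 a (b + c) = cross2 a b + cross2 a c"
  "cross2 (a - b) c = cross2 a c - cross2 b c" "cross2 a (b - c) = cross2 a b - cross2 a c"
  by (simp_all add: cross2_def algebra_simps)

lemma cross2_swap: "cross2 b a = - cross2 a b"
  by (simp add: cross2_def)

lemma continuous_on_cross2 [continuous_intros]:
  assumes "continuous_on S f" "continuous_on S g"
  shows "continuous_on S (\<lambda>x. cross2 (f x) (g x))"
  unfolding cross2_def by (intro continuous_intros assms)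

lemma tendsto_cross2 [tendsto_intros]:
  assumes "(f \<longlongrightarrow> a) F" "(g \<longlongrightarrow> b) F"
  shows "((\<lambda>x. cross2 (f x) (g x)) \<longlongrightarrow> cross2 a b) F"
  unfolding cross2_def by (intro tendsto_intros assms)

lemma cross2_eq_0D:
  assumes "cross2 a b = 0" "a \<noteq> 0"
  obtains t where "b = t *\<^sub>R a"
proof
  have "(a \<bullet> a) * b$i = (a \<bullet> b) * a$i" for i
    using assms(1) exhaust_2[of i]
    by (auto simp: cross2_def inner_vec_def sum_2 algebra_simps)
  then show "b = ((a \<bullet> b) / (a \<bullet> a)) *\<^sub>R a"
    using assms(2) by (simp add: vec_eq_iff field_simps)
qed

section \<open>Segments and chords\<close>

locale strictly_convex_domain =
  fixes \<Omega> :: "(real^2) set"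
  assumes open_dom: "open \<Omega>" and bounded_dom: "bounded \<Omega>"
    and nonempty_dom: "\<Omega> \<noteq> {}" and strictly_convex_dom: "strictly_convex \<Omega>"
begin

lemma open_segment_subset:
  "x \<in> closure \<Omega> \<Longrightarrow> y \<in> closure \<Omega> \<Longrightarrow> open_segment x y \<subseteq> \<Omega>"
  using strictly_convex_dom by (cases "x = y") (auto simp: strictly_convex_def)

lemma closed_segment_subset_closure:
  assumes "x \<in> closure \<Omega>" "y \<in> closure \<Omega>"
  shows "closed_segment x y \<subseteq> closure \<Omega>"
  using open_segment_subset[OF assms] assms closure_subset[of \<Omega>]
  by (auto simp: closed_segment_eq_open)

lemma frontier_closureD: "p \<in> frontier \<Omega> \<Longrightarrow> p \<in> closure \<Omega>"
  and frontier_notin: "p \<in> frontier \<Omega> \<Longrightarrow> p \<notin> \<Omega>"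
  using open_dom by (auto simp: frontier_def interior_open)

lemma compact_frontier: "compact (frontier \<Omega>)"
  using bounded_dom by (simp add: compact_frontier_bounded)

lemma segment_frontier_endpoint:
  assumes "p \<in> frontier \<Omega>" "q \<in> frontier \<Omega>" "z \<in> closed_segment p q" "z \<notin> \<Omega>"
  shows "z = p \<or> z = q"
  using assms open_segment_subset[of p q] frontier_closureD
  by (auto simp: open_segment_def)

text \<open>Were \<open>z\<close> on the line beyond \<open>p\<close> or \<open>q\<close>, that end
  would lie strictly between two points of the closure, hence in the open set \<Omega>, and could
  not be a frontier point.\<close>

lemma on_line_imp_on_segment:
  assumes p: "p \<in> frontier \<Omega>" and q: "q \<in> frontier \<Omega>" and z: "z \<in> closure \<Omega>"
    and "p \<noteq> q" and 0: "cross2 (q - p) (z - p) = 0"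
  shows "z \<in> closed_segment p q"
proof -
  obtain t where t: "z - p = t *\<^sub>R (q - p)"
    using cross2_eq_0D[OF 0] \<open>p \<noteq> q\<close> by auto
  have zt: "z = p + t *\<^sub>R (q - p)"
    using t by (metis add.commute diff_add_cancel)
  have "False" if "t < 0"
  proof -
    \<comment> \<open>The solution of \<open>(1 - s) * t + s = 0\<close>, which puts
      \<open>p\<close> at parameter \<open>s\<close> on the segment from \<open>z\<close> to
      \<open>q\<close>.\<close>
    define s where "s = - t / (1 - t)"
    have s: "0 < s" "s < 1" using that by (auto simp: s_def field_simps)
    have "(1 - s) * t + s = 0" using that by (simp add: s_def field_simps)
    moreover have "(1 - s) *\<^sub>R z + s *\<^sub>R q = p + ((1 - s) * t + s) *\<^sub>R (q - p)"
      unfolding zt by (simp add: algebra_simps)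
    ultimately have "(1 - s) *\<^sub>R z + s *\<^sub>R q = p" by simp
    moreover have z_neq: "z \<noteq> q"
    proof
      assume "z = q"
      then have "(1 - t) *\<^sub>R (q - p) = 0" using t by (simp add: algebra_simps)
      then show False using that \<open>p \<noteq> q\<close> by simp
    qed
    ultimately have "p \<in> open_segment z q"
      using s z_neq unfolding in_segment by metis
    then show False
      using open_segment_subset[OF z frontier_closureD[OF q]] frontier_notin[OF p] by blast
  qed
  moreover have "False" if "t > 1"
  proof -
    define s where "s = 1 / t"
    have s: "0 < s" "s < 1" using that by (auto simp: s_def field_simps)
    have "s * t = 1" using that by (simp add: s_def)
    moreover have "(1 - s) *\<^sub>R p + s *\<^sub>R z = p + (s * t) *\<^sub>R (q - p)"
      unfolding zt by (simp add: algebra_simps)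
    ultimately have "(1 - s) *\<^sub>R p + s *\<^sub>R z = q" by simp
    moreover have "p \<noteq> z" using zt that \<open>p \<noteq> q\<close> by auto
    ultimately have "q \<in> open_segment p z"
      using s unfolding in_segment by metis
    then show False
      using open_segment_subset[OF frontier_closureD[OF p] z] frontier_notin[OF q] by blast
  qed
  ultimately have "0 \<le> t" "t \<le> 1" by force+
  moreover have "z = (1 - t) *\<^sub>R p + t *\<^sub>R q"
    unfolding zt by (simp add: algebra_simps)
  ultimately show ?thesis unfolding in_segment by blast
qed

text \<open>Both chords lie on the line through \<open>p\<close> and \<open>z\<close>, and strict
  convexity leaves no third frontier point on the line of a chord.\<close>

lemma chord_through_unique:
  assumes p: "p \<in> frontier \<Omega>" and q: "q \<in> frontier \<Omega>" and r: "r \<in> frontier \<Omega>"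
    and z: "z \<in> \<Omega>" "z \<in> closed_segment p q" "z \<in> closed_segment p r"
  shows "q = r"
proof -
  have zp: "z \<noteq> p" and zr: "z \<noteq> r" using z frontier_notin p r by auto
  then have "p \<noteq> q" using z by auto
  obtain t where t: "z = (1 - t) *\<^sub>R p + t *\<^sub>R q" using z by (auto simp: in_segment)
  obtain s where s: "z = (1 - s) *\<^sub>R p + s *\<^sub>R r" using z by (auto simp: in_segment)
  have "s \<noteq> 0" using s zp by auto
  have "s *\<^sub>R (r - p) = z - p" using s by (simp add: algebra_simps)
  also have "\<dots> = t *\<^sub>R (q - p)" using t by (simp add: algebra_simps)
  finally have "cross2 (q - p) (s *\<^sub>R (r - p)) = 0" by simp
  then have "cross2 (q - p) (r - p) = 0" using \<open>s \<noteq> 0\<close> by simp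
  then have "r \<in> closed_segment p q"
    by (rule on_line_imp_on_segment[OF p q frontier_closureD[OF r] \<open>p \<noteq> q\<close>])
  then have "r = p \<or> r = q"
    using segment_frontier_endpoint[OF p q] frontier_notin[OF r] by blast
  then show ?thesis using z zp by auto
qed

text \<open>The triangle inequalities at \<open>z\<close> for the exchanged segments add up to the
  reverse of \<open>le\<close>, so both are equalities and \<open>z\<close> lies on the exchanged
  segments as well. Inside \<Omega> a chord is determined by one end and an inner point; on the
  frontier \<open>z\<close> is an end of all four segments.\<close>

lemma crossing_chords:
  assumes p: "p \<in> frontier \<Omega>" and q: "q \<in> frontier \<Omega>"
    and p': "p' \<in> frontier \<Omega>" and q': "q' \<in> frontier \<Omega>"
    and z: "z \<in> closed_segment p q" and z': "z \<in> closed_segment p' q'"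
    and le: "dist p q + dist p' q' \<le> dist p q' + dist p' q"
  shows "p = p' \<or> q = q'"
proof -
  have "dist p q = dist p z + dist z q" "dist p' q' = dist p' z + dist z q'"
    using z z' by (simp_all flip: between_mem_segment add: between)
  then have "dist p q' = dist p z + dist z q'" "dist p' q = dist p' z + dist z q"
    using le dist_triangle[of p q' z] dist_triangle[of p' q z] by linarith+
  then have zz: "z \<in> closed_segment p q'" "z \<in> closed_segment p' q"
    by (simp_all flip: between_mem_segment add: between)
  show ?thesis
  proof (cases "z \<in> \<Omega>")
    case True
    then show ?thesis using chord_through_unique[OF p q q' True z zz(1)] by simp
  next
    case False
    then have "z = p \<or> z = q" "z = p' \<or> z = q'" "z = p \<or> z = q'" "z = p' \<or> z = q"
      using segment_frontier_endpoint p q p' q' z z' zz by blast+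
    then show ?thesis by auto
  qed
qed

text \<open>A quantitative form of \<open>crossing_chords\<close> by compactness: pairs of chords
  that satisfy the exchange inequality and have both end distances at least \<open>e\<close>,
  together with a point on each, form a compact set \<open>K\<close>. The distance of the two points
  does not vanish on \<open>K\<close>, so it has a positive lower bound there.\<close>

lemma nearby_chords:
  assumes "e > 0"
  obtains d where "d > 0"
    "\<And>p q p' q' z z'. \<lbrakk>p \<in> frontier \<Omega>; q \<in> frontier \<Omega>; p' \<in> frontier \<Omega>; q' \<in> frontier \<Omega>;
       z \<in> closed_segment p q; z' \<in> closed_segment p' q'; dist z z' < d;
       dist p q + dist p' q' \<le> dist p q' + dist p' q\<rbrakk> \<Longrightarrow> dist p p' < e \<or> dist q q' < e"
proof -
  let ?F = "frontier \<Omega>" and ?I = "{0..1::real}"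
  let ?f = "\<lambda>(p, q, p', q', s, t). dist ((1 - s) *\<^sub>R p + s *\<^sub>R q) ((1 - t) *\<^sub>R p' + t *\<^sub>R (q' :: real^2))"
  define X where "X = ?F \<times> ?F \<times> ?F \<times> ?F \<times> ?I \<times> ?I"
  define K where "K = X \<inter> {(p, q, p', q', s, t). dist p q + dist p' q' \<le> dist p q' + dist p' q
      \<and> e \<le> dist p p' \<and> e \<le> dist q q'}"
  have "compact X"
    unfolding X_def by (intro compact_Times compact_frontier compact_Icc)
  moreover have "closed {(p, q, p', q', s, t). dist p q + dist p' q' \<le> dist p q' + dist p' q
      \<and> e \<le> dist p p' \<and> e \<le> dist q (q' :: real^2)}"
    unfolding case_prod_beta
    by (intro closed_Collect_conj closed_Collect_le continuous_intros)
  ultimately have K: "compact K"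
    unfolding K_def by (rule compact_Int_closed)
  have f: "continuous_on K ?f"
    unfolding case_prod_beta by (intro continuous_intros)
  have pos: "0 < ?f x" if "x \<in> K" for x
  proof -
    obtain p q p' q' s t where x: "x = (p, q, p', q', s, t)" by (metis surj_pair)
    have "(1 - s) *\<^sub>R p + s *\<^sub>R q \<noteq> (1 - t) *\<^sub>R p' + t *\<^sub>R q'"
    proof
      assume eq: "(1 - s) *\<^sub>R p + s *\<^sub>R q = (1 - t) *\<^sub>R p' + t *\<^sub>R q'"
      have "(1 - s) *\<^sub>R p + s *\<^sub>R q \<in> closed_segment p q"
        using that unfolding x in_segment K_def X_def by auto
      moreover have "(1 - s) *\<^sub>R p + s *\<^sub>R q \<in> closed_segment p' q'"
        using that unfolding x in_segment K_def X_def eq by auto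
      ultimately have "p = p' \<or> q = q'"
        using crossing_chords that unfolding x K_def X_def by blast
      then show False using that assms unfolding x K_def by auto
    qed
    then show ?thesis unfolding x by simp
  qed
  have "\<exists>d>0. \<forall>x\<in>K. d \<le> ?f x"
  proof (cases "K = {}")
    case True
    then show ?thesis by (intro exI[of _ 1]) simp
  next
    case False
    show ?thesis using continuous_attains_inf[OF K False f] pos by blast
  qed
  then obtain d where d: "d > 0" "\<And>x. x \<in> K \<Longrightarrow> d \<le> ?f x" by blast
  show ?thesis
  proof (rule that[OF d(1)])
    fix p q p' q' z z'
    assume F: "p \<in> ?F" "q \<in> ?F" "p' \<in> ?F" "q' \<in> ?F"
      and z: "z \<in> closed_segment p q" and z': "z' \<in> closed_segment p' q'" and lt: "dist z z' < d"
      and le: "dist p q + dist p' q' \<le> dist p q' + dist p' q"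
    obtain s where s: "z = (1 - s) *\<^sub>R p + s *\<^sub>R q" "s \<in> ?I" using z by (auto simp: in_segment)
    obtain t where t: "z' = (1 - t) *\<^sub>R p' + t *\<^sub>R q'" "t \<in> ?I" using z' by (auto simp: in_segment)
    have "(p, q, p', q', s, t) \<notin> K" using d(2)[of "(p, q, p', q', s, t)"] lt s t by auto
    then show "dist p p' < e \<or> dist q q' < e"
      using F s t le by (auto simp: K_def X_def)
  qed
qed

text \<open>By the intermediate value theorem the cross product vanishes somewhere on the segment
  from \<open>y\<close> to \<open>y'\<close>, and within the closure the line through
  \<open>p\<close> and \<open>q\<close> is just the chord.\<close>

lemma left_side_crossing:
  assumes p: "p \<in> frontier \<Omega>" and q: "q \<in> frontier \<Omega>"
    and y: "y \<in> closure \<Omega>" "y' \<in> closure \<Omega>"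
    and "(y \<in> left_side p q) \<noteq> (y' \<in> left_side p q)"
  obtains z where "z \<in> closed_segment y y'" "z \<in> closed_segment p q"
proof -
  let ?h = "\<lambda>z. cross2 (q - p) (z - p)"
  have "p \<noteq> q" using assms(5) by (auto simp: left_side_def)
  have "connected (?h ` closed_segment y y')"
    by (intro connected_continuous_image continuous_intros) simp
  then have "is_interval (?h ` closed_segment y y')" by (simp add: is_interval_connected_1)
  then have "0 \<in> ?h ` closed_segment y y'"
    using mem_is_interval_1_I[of "?h ` closed_segment y y'" "?h y" "?h y'" 0]
      mem_is_interval_1_I[of "?h ` closed_segment y y'" "?h y'" "?h y" 0] assms(5)
    by (auto simp: left_side_def)
  then obtain z where z: "z \<in> closed_segment y y'" "?h z = 0" by auto
  then have "z \<in> closed_segment p q"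
    using on_line_imp_on_segment[OF p q _ \<open>p \<noteq> q\<close>] closed_segment_subset_closure[OF y] by blast
  with z show ?thesis using that by blast
qed

text \<open>By connectedness, a ball around \<open>x\<close> that leaves \<Omega> meets the
  frontier, here at a distance from \<open>x\<close> below the infimum.\<close>

lemma ball_infdist_frontier_subset:
  assumes x: "x \<in> \<Omega>"
  shows "ball x (infdist x (frontier \<Omega>)) \<subseteq> \<Omega>"
proof (rule ccontr)
  assume sub: "\<not> ?thesis"
  let ?B = "ball x (infdist x (frontier \<Omega>))"
  obtain y where "y \<in> ?B" using sub by blast
  then have "dist x y < infdist x (frontier \<Omega>)" by simp
  then have "infdist x (frontier \<Omega>) > 0" by (rule le_less_trans[OF zero_le_dist])
  then have "x \<in> ?B \<inter> \<Omega>" using x by simp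
  then have "?B \<inter> \<Omega> \<noteq> {}" by blast
  moreover have "?B - \<Omega> \<noteq> {}" using sub by blast
  ultimately have "?B \<inter> frontier \<Omega> \<noteq> {}"
    using connected_Int_frontier[OF connected_ball] by blast
  then obtain s where "s \<in> frontier \<Omega>" "dist x s < infdist x (frontier \<Omega>)" by auto
  then show False using infdist_le[of s "frontier \<Omega>" x] by simp
qed

end

section \<open>Families of chords of minimal length\<close>

lemma closed_segment_polar:
  fixes p q z :: "'a::real_normed_vector"
  assumes "z \<in> closed_segment p q" "p \<noteq> q"
  obtains a b e where "norm e = 1" "a \<ge> 0" "b \<ge> 0" "p = z - a *\<^sub>R e" "q = z + b *\<^sub>R e"
proof -
  obtain t where t: "z = (1 - t) *\<^sub>R p + t *\<^sub>R q" "0 \<le> t" "t \<le> 1"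
    using assms(1) by (auto simp: in_segment)
  define n where "n = norm (q - p)"
  define e where "e = (1 / n) *\<^sub>R (q - p)"
  have n: "n > 0" using assms(2) by (simp add: n_def)
  have ne: "n *\<^sub>R e = q - p" using n by (simp add: e_def)
  have "p = z - t *\<^sub>R (q - p)" "q = z + (1 - t) *\<^sub>R (q - p)"
    unfolding t by (simp_all add: algebra_simps)
  then have pq: "p = z - (t * n) *\<^sub>R e" "q = z + ((1 - t) * n) *\<^sub>R e"
    by (metis ne scaleR_scaleR)+
  have "norm e = 1" using n by (simp add: e_def flip: n_def)
  moreover have "0 \<le> t * n" "0 \<le> (1 - t) * n" using t(2,3) n by simp_all
  ultimately show ?thesis using pq by (rule that)
qed

text \<open>In terms of angles: \<open>(a, b)\<close> and \<open>(c, d)\<close> lie on opposite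
  sides of the first axis and form an acute angle. This angle exceeds the one between
  \<open>(c, d)\<close> and the axis, so it has the larger sine.\<close>

lemma abs_le_abs_cross:
  fixes a b c d :: real
  assumes "a\<^sup>2 + b\<^sup>2 = 1" "b * d < 0" "a * c + b * d > 0"
  shows "\<bar>d\<bar> \<le> \<bar>a * d - b * c\<bar>"
proof -
  have "(b * d)\<^sup>2 \<le> (a * c) * - (b * d)"
    using mult_right_mono[of "- (b * d)" "a * c" "- (b * d)"] assms(2,3)
    by (simp add: power2_eq_square)
  moreover have "d\<^sup>2 = (a * d)\<^sup>2 + (b * d)\<^sup>2"
    using assms(1) by (simp add: power_mult_distrib flip: distrib_right)
  moreover have "(a * d - b * c)\<^sup>2 = (a * d)\<^sup>2 + (b * c)\<^sup>2 + 2 * ((a * c) * - (b * d))"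
    by (simp add: power2_eq_square algebra_simps)
  ultimately have "d\<^sup>2 \<le> (a * d - b * c)\<^sup>2"
    using zero_le_power2[of "b * d"] zero_le_power2[of "b * c"] by linarith
  then show ?thesis by (simp add: abs_le_square_iff)
qed

text \<open>Since the angle is not acute, the squared norm is at most
  \<open>a\<^sup>2 + b\<^sup>2\<close>; the missing \<open>2 * a * b\<close> pays for the saving of
  \<open>m / 2\<close>.\<close>

lemma norm_obtuse_sum_le:
  fixes e f :: "'a::real_inner"
  assumes "norm e = 1" "norm f = 1" "e \<bullet> f \<le> 0" "m \<ge> 0" "a \<ge> m" "b \<ge> m"
  shows "norm (a *\<^sub>R e + b *\<^sub>R f) \<le> a + b - m / 2"
proof -
  have "(norm (a *\<^sub>R e + b *\<^sub>R f))\<^sup>2 = a\<^sup>2 + b\<^sup>2 + 2 * (a * b) * (e \<bullet> f)"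
    using assms(1,2)
    by (simp add: power2_norm_eq_inner inner_simps inner_commute norm_eq_1)
       (simp add: power2_eq_square algebra_simps)
  also have "\<dots> \<le> a\<^sup>2 + b\<^sup>2"
    using assms by (simp add: mult_nonneg_nonpos)
  also have "\<dots> \<le> (a + b - m / 2)\<^sup>2"
  proof -
    have "m * b \<le> a * b" "m * a \<le> a * b"
      using assms mult_right_mono[of m a b] mult_right_mono[of m b a] by (auto simp: mult.commute)
    then have "0 \<le> 2 * (a * b) - m * a - m * b + (m / 2)\<^sup>2"
      using zero_le_power2[of "m / 2"] by linarith
    then show ?thesis by (simp add: power2_eq_square algebra_simps)
  qed
  finally show ?thesis
    by (rule power2_le_imp_le) (use assms in linarith)
qed

text \<open>
  If the directions of the two chords form an obtuse angle, then swapping their ends shortens them.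
  Otherwise the law of sines locates the intersection of the two lines within \<open>\<bar>h\<bar>\<close> of \<open>z\<close> and \<open>z'\<close>.
\<close>
lemma opposite_chords_meet:
  assumes z: "z \<in> closed_segment p q" and z': "z' \<in> closed_segment p' q'"
    and far: "dist z p \<ge> m" "dist z q \<ge> m" "dist z' p' \<ge> m" "dist z' q' \<ge> m"
    and v: "norm v = 1" and h: "z' = z + h *\<^sub>R v" "2 * \<bar>h\<bar> < m"
    and cross: "cross2 v (q - p) > 0" "cross2 v (q' - p') < 0"
    and le: "dist p q + dist p' q' \<le> dist p q' + dist p' q"
  shows "closed_segment p q \<inter> closed_segment p' q' \<noteq> {}"
proof -
  have "p \<noteq> q" "p' \<noteq> q'" using cross by auto
  obtain a b e where e: "norm e = 1" "a \<ge> 0" "b \<ge> 0" "p = z - a *\<^sub>R e" "q = z + b *\<^sub>R e"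
    using closed_segment_polar[OF z \<open>p \<noteq> q\<close>] .
  obtain a' b' f where f: "norm f = 1" "a' \<ge> 0" "b' \<ge> 0" "p' = z' - a' *\<^sub>R f" "q' = z' + b' *\<^sub>R f"
    using closed_segment_polar[OF z' \<open>p' \<noteq> q'\<close>] .
  have m: "a \<ge> m" "b \<ge> m" "a' \<ge> m" "b' \<ge> m" "m > 0"
    using far e f h by (auto simp: dist_norm)
  have qp: "q - p = (a + b) *\<^sub>R e" "q' - p' = (a' + b') *\<^sub>R f"
    unfolding e f by (simp_all add: algebra_simps)
  \<comment> \<open>Coordinates of \<open>e\<close> and \<open>f\<close> in the orthonormal frame of
    \<open>v\<close> and \<open>v\<close> turned by a right angle. The signs of \<open>e2\<close>
    and \<open>f2\<close> say that the chords cross the line of \<open>v\<close> in opposite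
    directions.\<close>
  define e1 e2 f1 f2 where "e1 = e \<bullet> v" and "e2 = cross2 v e" and "f1 = f \<bullet> v" and "f2 = cross2 v f"
  have e2: "e2 > 0" and f2: "f2 < 0"
    using cross m by (auto simp: qp e2_def f2_def zero_less_mult_iff mult_less_0_iff)
  have v1: "v$1 * v$1 + v$2 * v$2 = 1" and e11: "e$1 * e$1 + e$2 * e$2 = 1"
    and f11: "f$1 * f$1 + f$2 * f$2 = 1"
    using v e(1) f(1) by (simp_all add: norm_eq_1 inner_vec_def sum_2)
  have e12: "e1\<^sup>2 + e2\<^sup>2 = 1" and f12: "f1\<^sup>2 + f2\<^sup>2 = 1"
    using v1 e11 f11 unfolding e1_def e2_def f1_def f2_def cross2_def inner_vec_def sum_2
    by (simp add: power2_eq_square, algebra)+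
  have ef: "e \<bullet> f = e1 * f1 + e2 * f2"
    using v1 unfolding e1_def e2_def f1_def f2_def cross2_def inner_vec_def sum_2
    by (simp, algebra)
  show ?thesis
  proof (cases "e \<bullet> f \<le> 0")
    case True
    have "dist p q' = norm ((a *\<^sub>R e + b' *\<^sub>R f) + h *\<^sub>R v)"
      unfolding e f h dist_norm by (subst norm_minus_commute) (simp add: algebra_simps)
    also have "\<dots> \<le> norm (a *\<^sub>R e + b' *\<^sub>R f) + \<bar>h\<bar>"
      using norm_triangle_ineq[of "a *\<^sub>R e + b' *\<^sub>R f" "h *\<^sub>R v"] v by simp
    also have "\<dots> \<le> a + b' - m / 2 + \<bar>h\<bar>"
      using norm_obtuse_sum_le[OF e(1) f(1) True _ m(1,4)] m by simp
    finally have 1: "dist p q' \<le> a + b' - m / 2 + \<bar>h\<bar>" .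
    have "dist p' q = norm ((b *\<^sub>R e + a' *\<^sub>R f) + (- h) *\<^sub>R v)"
      unfolding e f h dist_norm by (subst norm_minus_commute) (simp add: algebra_simps)
    also have "\<dots> \<le> norm (b *\<^sub>R e + a' *\<^sub>R f) + \<bar>h\<bar>"
      using norm_triangle_ineq[of "b *\<^sub>R e + a' *\<^sub>R f" "(- h) *\<^sub>R v"] v by simp
    also have "\<dots> \<le> b + a' - m / 2 + \<bar>h\<bar>"
      using norm_obtuse_sum_le[OF e(1) f(1) True _ m(2,3)] m by simp
    finally have 2: "dist p' q \<le> b + a' - m / 2 + \<bar>h\<bar>" .
    have "dist p q = a + b" "dist p' q' = a' + b'"
      using e(1) f(1) m by (simp_all add: dist_norm norm_minus_commute[of p] norm_minus_commute[of p'] qp)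
    \<comment> \<open>Each exchanged segment saves \<open>m / 2\<close> and loses at most
      \<bar>h\<bar>; as \<open>2 * \<bar>h\<bar> < m\<close>, this contradicts
      \<open>le\<close>.\<close>
    then show ?thesis using 1 2 le h by linarith
  next
    case False
    define c where "c = e1 * f2 - e2 * f1"
    have bd: "\<bar>f2\<bar> \<le> \<bar>c\<bar>"
      unfolding c_def using abs_le_abs_cross[OF e12, of f2 f1] False ef e2 f2 by (simp add: mult_pos_neg)
    have bd': "\<bar>e2\<bar> \<le> \<bar>c\<bar>"
    proof -
      have "f2 * e2 < 0" "f1 * e1 + f2 * e2 > 0"
        using False ef mult_neg_pos[OF f2 e2] by (simp_all add: mult.commute)
      then have "\<bar>e2\<bar> \<le> \<bar>f1 * e2 - f2 * e1\<bar>" by (rule abs_le_abs_cross[OF f12])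
      also have "f1 * e2 - f2 * e1 = - c" by (simp add: c_def)
      finally show ?thesis by simp
    qed
    have c: "c \<noteq> 0" using bd f2 by auto
    \<comment> \<open>Cramer's rule for \<open>z + s *\<^sub>R e = z' + t *\<^sub>R f\<close>, whose
      determinant \<open>c\<close> is the cross product of \<open>e\<close> and \<open>f\<close>.
      The bounds on \<open>c\<close> keep both parameters within \<bar>h\<bar>, hence inside both
      segments.\<close>
    define s t where "s = h * f2 / c" and "t = h * e2 / c"
    have s: "\<bar>s\<bar> \<le> \<bar>h\<bar>" and t: "\<bar>t\<bar> \<le> \<bar>h\<bar>"
      using bd bd' c mult_left_mono[OF bd, of "\<bar>h\<bar>"] mult_left_mono[OF bd', of "\<bar>h\<bar>"]
      by (simp_all add: s_def t_def abs_mult field_simps)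
    \<comment> \<open>Both sides have component \<open>c\<close> along \<open>v\<close> and
      component 0 across it.\<close>
    have "f2 *\<^sub>R e - e2 *\<^sub>R f = c *\<^sub>R v"
      using v1 unfolding c_def e1_def e2_def f1_def f2_def cross2_def inner_vec_def sum_2 vec_eq_iff forall_2
      by (simp, intro conjI; algebra)
    then have "(h / c) *\<^sub>R (f2 *\<^sub>R e - e2 *\<^sub>R f) = (h / c) *\<^sub>R (c *\<^sub>R v)" by simp
    then have "s *\<^sub>R e - t *\<^sub>R f = h *\<^sub>R v"
      using c by (simp add: s_def t_def algebra_simps)
    then have eq: "z + s *\<^sub>R e = z' + t *\<^sub>R f"
      unfolding h by (simp add: algebra_simps)
    have seg: "x + r *\<^sub>R w \<in> closed_segment (x - k *\<^sub>R w) (x + l *\<^sub>R w)"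
      if "- k \<le> r" "r \<le> l" "0 < k" "0 < l" for x w :: "real^2" and r k l
    proof -
      define u where "u = (r + k) / (l + k)"
      have u: "0 \<le> u" "u \<le> 1" "u * (l + k) = r + k" using that by (simp_all add: u_def)
      then have "x + r *\<^sub>R w = x + (u * (l + k) - k) *\<^sub>R w" by simp
      also have "\<dots> = (1 - u) *\<^sub>R (x - k *\<^sub>R w) + u *\<^sub>R (x + l *\<^sub>R w)"
        by (simp add: algebra_simps)
      finally show ?thesis using u unfolding in_segment by blast
    qed
    have "z + s *\<^sub>R e \<in> closed_segment p q"
      unfolding e using s m h by (intro seg) auto
    moreover have "z + s *\<^sub>R e \<in> closed_segment p' q'"
      unfolding eq f using t m h by (intro seg) auto
    ultimately show ?thesis by blast
  qed
qed

section \<open>Nested half planes and the number of sides\<close>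

lemma finite_chain_least:
  assumes "finite S" "S \<noteq> {}" "\<And>X Y. X \<in> S \<Longrightarrow> Y \<in> S \<Longrightarrow> X \<subseteq> Y \<or> Y \<subseteq> X"
  shows "\<exists>X\<in>S. \<forall>Y\<in>S. X \<subseteq> Y"
proof -
  obtain X where "X \<in> S" "\<And>Y. Y \<in> S \<Longrightarrow> Y \<subseteq> X \<Longrightarrow> X = Y"
    using finite_has_minimal[OF assms(1,2)] by metis
  then show ?thesis using assms(3) by blast
qed

text \<open>One half of the median condition; the other half is the same property of
  \<open>- u\<close>. The direction \<open>w\<close> has unit length so that directions of a
  sequence of functions have a limit point.\<close>

definition half_disc_property :: "(real^2 \<Rightarrow> real) \<Rightarrow> real^2 \<Rightarrow> real \<Rightarrow> bool" where
  "half_disc_property u x r \<longleftrightarrow>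
     (\<exists>w. norm w = 1 \<and> (\<forall>y\<in>ball x r. 0 \<le> cross2 w (y - x) \<longrightarrow> u x \<le> u y))"

text \<open>To be instantiated with \<open>p i\<close> the downward and \<open>q i\<close> the
  upward jumps. Minimal total length enters as the inequality for exchanging the ends of two
  chords.\<close>

locale chord_family = strictly_convex_domain +
  fixes A :: "'i set" and p q :: "'i \<Rightarrow> real^2"
  assumes finite_A: "finite A"
    and p_frontier: "\<And>i. i \<in> A \<Longrightarrow> p i \<in> frontier \<Omega>"
    and q_frontier: "\<And>i. i \<in> A \<Longrightarrow> q i \<in> frontier \<Omega>"
    and inj_p: "inj_on p A" and inj_q: "inj_on q A"
    and p_neq_q: "\<And>i j. i \<in> A \<Longrightarrow> j \<in> A \<Longrightarrow> p i \<noteq> q j"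
    and minimal: "\<And>i j. i \<in> A \<Longrightarrow> j \<in> A \<Longrightarrow>
       dist (p i) (q i) + dist (p j) (q j) \<le> dist (p i) (q j) + dist (p j) (q i)"
begin

abbreviation "chord i \<equiv> closed_segment (p i) (q i)"
abbreviation "side i \<equiv> left_side (p i) (q i)"

definition height :: "real^2 \<Rightarrow> nat" where
  "height x = card {i \<in> A. x \<in> side i}"

text \<open>By minimality, an intersection would force a common start or a common end, which
  injectivity excludes.\<close>

lemma chords_disjoint:
  assumes "i \<in> A" "j \<in> A" "i \<noteq> j"
  shows "chord i \<inter> chord j = {}"
  using crossing_chords[of "p i" "q i" "p j" "q j"] assms p_frontier q_frontier minimal
    inj_onD[OF inj_p, of i j] inj_onD[OF inj_q, of i j] by blast

lemma chord_subset_closure: "i \<in> A \<Longrightarrow> chord i \<subseteq> closure \<Omega>"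
  using closed_segment_subset_closure p_frontier q_frontier frontier_closureD by simp

text \<open>Changing the side of chord \<open>j\<close> along chord \<open>i\<close> would mean
  crossing chord \<open>j\<close>, but the chords are disjoint. A chord lies on the edge of its own
  side, hence outside it.\<close>

lemma side_constant_on_chord:
  assumes "i \<in> A" "j \<in> A" "y \<in> chord i" "y' \<in> chord i"
  shows "y \<in> side j \<longleftrightarrow> y' \<in> side j"
proof (cases "i = j")
  case True
  have "y \<notin> side i" if y: "y \<in> chord i" for y
  proof -
    obtain u where "y = (1 - u) *\<^sub>R p i + u *\<^sub>R q i" using y by (auto simp: in_segment)
    then have "y - p i = u *\<^sub>R (q i - p i)" by (simp add: algebra_simps)
    then show ?thesis by (simp add: left_side_def)
  qed
  then show ?thesis using assms True by blast
next
  case False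
  show ?thesis
  proof (rule ccontr)
    assume "(y \<in> side j) \<noteq> (y' \<in> side j)"
    then obtain z where "z \<in> closed_segment y y'" "z \<in> chord j"
      using left_side_crossing[OF p_frontier[OF assms(2)] q_frontier[OF assms(2)]]
        chord_subset_closure[OF assms(1)] assms(3,4) by blast
    moreover have "closed_segment y y' \<subseteq> chord i"
      using assms(3,4) by (simp add: closed_segment_subset)
    ultimately show False using chords_disjoint[OF assms(1,2) False] by blast
  qed
qed

text \<open>This is how boundary values control the height in the interior: the value on a chord is
  the value at its ends.\<close>

lemma height_constant_on_chord:
  assumes "i \<in> A" "y \<in> chord i" "y' \<in> chord i"
  shows "height y = height y'"
  unfolding height_def
  using side_constant_on_chord[OF assms(1) _ assms(2,3)] by (metis (lifting))

text \<open>Otherwise a segment inside the ball crosses both chords, in opposite directions. The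
  crossing points are less than \<open>2 * r\<close> apart, while all ends are at least
  \<open>9 * r\<close> away from them, so \<open>opposite_chords_meet\<close> makes two disjoint
  chords intersect.\<close>

lemma sides_nested:
  assumes x: "x \<in> \<Omega>" and i: "i \<in> A" and j: "j \<in> A"
    and r: "r = infdist x (frontier \<Omega>) / 10"
  shows "side i \<inter> ball x r \<subseteq> side j \<or> side j \<inter> ball x r \<subseteq> side i"
proof (rule ccontr)
  assume "\<not> ?thesis"
  then obtain y y' where y: "y \<in> side i" "y \<notin> side j" "y \<in> ball x r"
    and y': "y' \<in> side j" "y' \<notin> side i" "y' \<in> ball x r" by blast
  have "i \<noteq> j" using y y' by auto
  have rpos: "r > 0" using y(3) le_less_trans[OF zero_le_dist, of x y r] by simp
  have "10 * r = infdist x (frontier \<Omega>)" using r by simp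
  then have "ball x (10 * r) \<subseteq> \<Omega>"
    using ball_infdist_frontier_subset[OF x] by (simp only:)
  then have "ball x r \<subseteq> \<Omega>" using rpos subset_ball[of r "10 * r" x] by simp
  then have cl: "y \<in> closure \<Omega>" "y' \<in> closure \<Omega>" using y(3) y'(3) closure_subset by blast+
  obtain z where z: "z \<in> closed_segment y y'" "z \<in> chord i"
    using left_side_crossing[OF p_frontier[OF i] q_frontier[OF i] cl] y y' by blast
  obtain z' where z': "z' \<in> closed_segment y y'" "z' \<in> chord j"
    using left_side_crossing[OF p_frontier[OF j] q_frontier[OF j] cl] y y' by blast
  have "closed_segment y y' \<subseteq> ball x r"
    using y(3) y'(3) by (simp add: closed_segment_subset)
  then have zb: "dist x z < r" "dist x z' < r" using z z' by auto
  have far: "dist w s \<ge> 9 * r" if "dist x w < r" "s \<in> frontier \<Omega>" for w s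
    using infdist_le[OF that(2), of x] that(1) r dist_triangle[of x s w] by linarith
  have ci: "cross2 (q i - p i) (y' - y) < 0"
    using y(1) y'(2) by (simp add: left_side_def cross2_linear)
  have cj: "cross2 (q j - p j) (y' - y) > 0"
    using y(2) y'(1) by (simp add: left_side_def cross2_linear)
  define n where "n = norm (y' - y)"
  define v where "v = (1 / n) *\<^sub>R (y' - y)"
  have n: "n > 0" using ci by (auto simp: n_def)
  then have nv: "norm v = 1" by (simp add: v_def n_def)
  have yv: "y' - y = n *\<^sub>R v" using n by (simp add: v_def)
  obtain s where "z = (1 - s) *\<^sub>R y + s *\<^sub>R y'" using z by (auto simp: in_segment)
  then have s: "z = y + s *\<^sub>R (y' - y)" by (simp add: algebra_simps)
  obtain t where "z' = (1 - t) *\<^sub>R y + t *\<^sub>R y'" using z' by (auto simp: in_segment)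
  then have t: "z' = y + t *\<^sub>R (y' - y)" by (simp add: algebra_simps)
  define h where "h = (t - s) * n"
  have zz: "z' = z + h *\<^sub>R v"
    unfolding s t yv h_def by (simp add: algebra_simps)
  have "\<bar>h\<bar> = dist z z'" using nv by (simp add: zz dist_norm)
  also have "\<dots> < 2 * r" using dist_triangle[of z z' x] zb by (simp add: dist_commute)
  \<comment> \<open>Twice the gap is below \<open>4 * r\<close>, and the factor 10 in
    \<open>r\<close> leaves \<open>9 * r\<close> for the distance to the ends.\<close>
  finally have hr: "2 * \<bar>h\<bar> < 9 * r" using rpos by simp
  have "chord i \<inter> chord j \<noteq> {}"
  proof (rule opposite_chords_meet[OF z(2) z'(2) _ _ _ _ nv zz hr])
    show "cross2 v (q i - p i) > 0" "cross2 v (q j - p j) < 0"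
      using ci cj n by (simp_all add: cross2_swap[of v] yv mult_less_0_iff zero_less_mult_iff)
  qed (use far zb p_frontier q_frontier minimal i j in auto)
  then show False using chords_disjoint[OF i j \<open>i \<noteq> j\<close>] by blast
qed

text \<open>Among the nested sides containing \<open>x\<close> the smallest one decides: shifting
  its edge to \<open>x\<close> gives a half disc inside it, hence inside every side that contains
  \<open>x\<close>, so the count cannot drop there. For \<open>- height\<close> the same is done
  with the complements of the sides that miss \<open>x\<close>.\<close>

lemma half_disc_property_height:
  assumes x: "x \<in> \<Omega>" and r: "r = infdist x (frontier \<Omega>) / 10"
  shows "half_disc_property (\<lambda>y. real (height y)) x r"
    and "half_disc_property (\<lambda>y. - real (height y)) x r"
proof -
  have unit: "norm (\<chi> k. if k = 1 then 1 else 0 :: real^2) = 1"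
    by (simp add: norm_vec_def L2_set_def sum_2)
  have pq: "norm (q i - p i) > 0" if "i \<in> A" for i
    using p_neq_q[OF that that] by auto
  show "half_disc_property (\<lambda>y. real (height y)) x r"
  proof (cases "{i \<in> A. x \<in> side i} = {}")
    \<comment> \<open>The height of \<open>x\<close> is the least possible one, so any unit vector
      serves as direction.\<close>
    case True
    then have "height x = 0" by (simp only: height_def card.empty)
    then show ?thesis using unit unfolding half_disc_property_def by auto
  next
    case False
    let ?S = "(\<lambda>i. side i \<inter> ball x r) ` {i \<in> A. x \<in> side i}"
    have "\<exists>X\<in>?S. \<forall>Y\<in>?S. X \<subseteq> Y"
      by (rule finite_chain_least) (use finite_A False sides_nested[OF x _ _ r] in auto)
    then obtain k where k: "k \<in> A" "x \<in> side k"
      and least: "\<And>i. i \<in> A \<Longrightarrow> x \<in> side i \<Longrightarrow> side k \<inter> ball x r \<subseteq> side i" by auto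
    define w where "w = (1 / norm (q k - p k)) *\<^sub>R (q k - p k)"
    have "norm w = 1" using pq[OF k(1)] by (simp add: w_def)
    moreover have "height x \<le> height y" if "y \<in> ball x r" "0 \<le> cross2 w (y - x)" for y
    proof -
      have "0 \<le> cross2 (q k - p k) (y - x)"
        using that(2) pq[OF k(1)] by (simp add: w_def zero_le_divide_iff)
      then have "y \<in> side k" using k(2) by (simp add: left_side_def cross2_linear)
      then have "{i \<in> A. x \<in> side i} \<subseteq> {i \<in> A. y \<in> side i}" using least that(1) by blast
      then show ?thesis unfolding height_def using finite_A by (intro card_mono) auto
    qed
    ultimately show ?thesis unfolding half_disc_property_def by auto
  qed
  show "half_disc_property (\<lambda>y. - real (height y)) x r"
  proof (cases "{i \<in> A. x \<notin> side i} = {}")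
    case True
    then have "{i \<in> A. x \<in> side i} = A" by blast
    then have "height y \<le> height x" for y
      unfolding height_def using finite_A by (intro card_mono) auto
    then show ?thesis using unit unfolding half_disc_property_def by auto
  next
    case False
    let ?S = "(\<lambda>i. ball x r - side i) ` {i \<in> A. x \<notin> side i}"
    have "\<exists>X\<in>?S. \<forall>Y\<in>?S. X \<subseteq> Y"
    proof (rule finite_chain_least)
      fix X Y assume "X \<in> ?S" "Y \<in> ?S"
      then obtain i j where "i \<in> A" "j \<in> A" "X = ball x r - side i" "Y = ball x r - side j" by auto
      then show "X \<subseteq> Y \<or> Y \<subseteq> X" using sides_nested[OF x _ _ r, of i j] by blast
    qed (use finite_A False in auto)
    then obtain k where k: "k \<in> A" "x \<notin> side k"
      and least: "\<And>i. i \<in> A \<Longrightarrow> x \<notin> side i \<Longrightarrow> ball x r - side k \<subseteq> ball x r - side i" by auto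
    \<comment> \<open>The direction is reversed, since the complement of \<open>side k\<close> lies
      to the right of the chord.\<close>
    define w where "w = (1 / norm (q k - p k)) *\<^sub>R (p k - q k)"
    have "norm w = 1" using pq[OF k(1)] by (simp add: w_def norm_minus_commute)
    moreover have "height y \<le> height x" if "y \<in> ball x r" "0 \<le> cross2 w (y - x)" for y
    proof -
      have "0 \<le> cross2 (p k - q k) (y - x)"
        using that(2) pq[OF k(1)] by (simp add: w_def zero_le_divide_iff)
      then have "y \<notin> side k" using k(2) by (simp add: left_side_def cross2_linear)
      then have "{i \<in> A. y \<in> side i} \<subseteq> {i \<in> A. x \<in> side i}" using least that(1) by blast
      then show ?thesis unfolding height_def using finite_A by (intro card_mono) auto
    qed
    ultimately show ?thesis unfolding half_disc_property_def by auto
  qed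
qed

text \<open>Let \<open>z\<close> be the first point of the segment that lies on any chord. Only the
  chord through \<open>z\<close> can have \<open>x\<close> and \<open>z\<close> on different sides,
  so the counts differ by at most one.\<close>

lemma height_first_chord:
  assumes x: "x \<in> closure \<Omega>" and y: "y \<in> closure \<Omega>" and ne: "height x \<noteq> height y"
  obtains i z where "i \<in> A" "z \<in> chord i" "z \<in> closed_segment x y"
    "\<bar>real (height x) - real (height z)\<bar> \<le> 1"
proof -
  let ?l = "\<lambda>t. x + t *\<^sub>R (y - x)"
  have seg: "?l ` {0..t} = closed_segment x (?l t)" if "0 \<le> t" for t
  proof (cases "t = 0")
    case False
    show ?thesis
    proof (intro set_eqI iffI)
      fix w assume "w \<in> ?l ` {0..t}"
      then obtain s where "w = ?l s" "s \<in> {0..t}" by (rule imageE)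
      then show "w \<in> closed_segment x (?l t)" unfolding in_segment using that False
        by (intro exI[of _ "s / t"]) (auto simp: algebra_simps)
    next
      fix w assume "w \<in> closed_segment x (?l t)"
      then obtain s where s: "w = (1 - s) *\<^sub>R x + s *\<^sub>R ?l t" "0 \<le> s" "s \<le> 1" by (auto simp: in_segment)
      then have "w = ?l (s * t)" by (simp add: algebra_simps)
      then show "w \<in> ?l ` {0..t}" using s that by (auto simp: mult_left_le_one_le)
    qed
  qed simp
  define T where "T = {t \<in> {0..1}. ?l t \<in> (\<Union>i\<in>A. chord i)}"
  have "T = {0..1} \<inter> ?l -` (\<Union>i\<in>A. chord i)" by (auto simp: T_def)
  moreover have "closed (\<Union>i\<in>A. chord i)" using finite_A by (intro closed_UN) auto
  moreover have "continuous_on {0..1} ?l" by (intro continuous_intros)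
  ultimately have "closed T" by (simp add: continuous_closed_preimage)
  moreover have "bounded T" by (rule bounded_subset[of "{0..1}"]) (auto simp: T_def)
  ultimately have cT: "compact T" by (simp add: compact_eq_bounded_closed)
  have "\<exists>i\<in>A. (x \<in> side i) \<noteq> (y \<in> side i)"
  proof (rule ccontr)
    assume "\<not> ?thesis"
    then have "{i \<in> A. x \<in> side i} = {i \<in> A. y \<in> side i}" by blast
    then show False using ne by (simp add: height_def)
  qed
  then obtain i where i: "i \<in> A" "(x \<in> side i) \<noteq> (y \<in> side i)" by blast
  obtain z where z: "z \<in> closed_segment x y" "z \<in> chord i"
    using left_side_crossing[OF p_frontier[OF i(1)] q_frontier[OF i(1)] x y i(2)] .
  then have "z \<in> ?l ` {0..1}" using seg[of 1] by simp
  then have "T \<noteq> {}" using z(2) i(1) by (auto simp: T_def)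
  then obtain t where t: "t \<in> T" "\<And>s. s \<in> T \<Longrightarrow> t \<le> s"
    using compact_attains_inf[OF cT] by blast
  define z where "z = ?l t"
  obtain i where i: "i \<in> A" "z \<in> chord i" using t(1) by (auto simp: T_def z_def)
  have "z \<in> ?l ` {0..1}" using t(1) unfolding z_def T_def by blast
  then have zs: "z \<in> closed_segment x y" using seg[of 1] by simp
  have zc: "z \<in> closure \<Omega>" using chord_subset_closure i by blast
  have same: "x \<in> side j \<longleftrightarrow> z \<in> side j" if j: "j \<in> A" "j \<noteq> i" for j
  proof (rule ccontr)
    assume "\<not> ?thesis"
    then obtain z' where z': "z' \<in> closed_segment x z" "z' \<in> chord j"
      using left_side_crossing[OF p_frontier[OF j(1)] q_frontier[OF j(1)] x zc] by blast
    moreover have "closed_segment x z = ?l ` {0..t}" using seg[of t] t(1) by (simp add: z_def T_def)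
    ultimately obtain s where "z' = ?l s" "s \<in> {0..t}" by blast
    then have s: "z' = ?l s" "0 \<le> s" "s \<le> t" by auto
    then have "s \<in> T" using z'(2) j(1) t(1) by (auto simp: T_def)
    then have "s = t" using t(2) s by force
    then show False using z'(2) s i j chords_disjoint[of i j] by (auto simp: z_def)
  qed
  \<comment> \<open>Chord \<open>i\<close> is the one exception: \<open>z\<close> lies on it and so
    outside \<open>side i\<close>, whereas \<open>x\<close> may lie in
    \<open>side i\<close>.\<close>
  have "height w \<le> Suc (height w')" if "\<And>j. j \<in> A \<Longrightarrow> j \<noteq> i \<Longrightarrow> w \<in> side j \<Longrightarrow> w' \<in> side j" for w w'
  proof -
    have "card {j \<in> A. w \<in> side j} \<le> card (insert i {j \<in> A. w' \<in> side j})"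
      using that finite_A by (intro card_mono) auto
    also have "\<dots> \<le> Suc (card {j \<in> A. w' \<in> side j})"
      using finite_A by (simp add: card_insert_if)
    finally show ?thesis by (simp add: height_def)
  qed
  then have "height x \<le> Suc (height z)" "height z \<le> Suc (height x)"
    using same by blast+
  then show ?thesis using that[OF i zs] by linarith
qed

end

section \<open>Discretisation of the boundary values\<close>

definition dir :: "real \<Rightarrow> real^2" where
  "dir t = vector [cos t, sin t]"

lemma dir_nth [simp]: "dir t $ 1 = cos t" "dir t $ 2 = sin t"
  by (simp_all add: dir_def)

lemma norm_dir [simp]: "norm (dir t) = 1"
  by (simp add: norm_vec_def L2_set_def sum_2)

lemma cross2_dir: "cross2 (dir s) (dir t) = sin (t - s)"
  by (simp add: cross2_def sin_diff)

lemma dir_eqD: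
  assumes "dir s = dir t" "s < t"
  shows "t \<ge> s + 2 * pi"
proof -
  have "cos s = cos t" "sin s = sin t" using assms(1) by (metis dir_nth)+
  then have "cos (t - s) = 1" by (simp add: cos_diff flip: power2_eq_square)
  then obtain n :: int where n: "t - s = real_of_int n * (2 * pi)"
    by (auto simp: cos_one_2pi_int mult.assoc)
  then have "0 < real_of_int n * (2 * pi)" using assms(2) by (metis diff_gt_0_iff_gt)
  then have "real_of_int n \<ge> 1" by (simp add: zero_less_mult_iff)
  then have "real_of_int n * (2 * pi) \<ge> 1 * (2 * pi)" by (intro mult_right_mono) auto
  then show ?thesis using n by linarith
qed

lemma continuous_on_dir: "continuous_on S dir"
proof -
  have eq: "dir = (\<lambda>t. cos t *\<^sub>R dir 0 + sin t *\<^sub>R dir (pi / 2))"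
    by (auto simp: fun_eq_iff vec_eq_iff forall_2)
  show ?thesis by (subst eq) (intro continuous_intros)
qed

lemma unit_vector_dir:
  fixes v :: "real^2"
  assumes "norm v = 1"
  obtains t where "0 \<le> t" "t < 2 * pi" "v = dir t"
proof -
  have "(v$1)\<^sup>2 + (v$2)\<^sup>2 = 1"
    using assms by (simp add: norm_eq_1 inner_vec_def sum_2 power2_eq_square)
  then obtain t where "0 \<le> t" "t < 2 * pi" "v$1 = cos t" "v$2 = sin t"
    using sincos_total_2pi by metis
  then show ?thesis using that[of t] by (simp add: vec_eq_iff forall_2)
qed

text \<open>Both convexity and the counterclockwise orientation are contained in
  \<open>curve_positive\<close>: points met in order within one turn make a left turn.\<close>

locale boundary_curve = strictly_convex_domain +
  fixes \<gamma> :: "real \<Rightarrow> real^2"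
  assumes cont_curve: "continuous_on UNIV \<gamma>"
    and curve_frontier: "\<gamma> t \<in> frontier \<Omega>"
    and curve_periodic: "\<gamma> (2 * pi) = \<gamma> 0"
    and curve_surj: "s \<in> frontier \<Omega> \<Longrightarrow> \<exists>t\<in>{0..<2 * pi}. s = \<gamma> t"
    and curve_inj: "a < b \<Longrightarrow> b < a + 2 * pi \<Longrightarrow> \<gamma> a \<noteq> \<gamma> b"
    and curve_positive: "a < b \<Longrightarrow> b < c \<Longrightarrow> c < a + 2 * pi \<Longrightarrow> 0 < cross2 (\<gamma> b - \<gamma> a) (\<gamma> c - \<gamma> a)"

context strictly_convex_domain
begin

text \<open>The nearer of two such points would lie strictly between \<open>x0\<close> and the
  farther one, hence in \<Omega>.\<close>

lemma radial_unique:
  assumes "x0 \<in> \<Omega>" "x0 + a *\<^sub>R v \<in> frontier \<Omega>" "x0 + b *\<^sub>R v \<in> frontier \<Omega>" "0 < a" "0 < b"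
  shows "a = b"
proof -
  have False if "0 < a" "a < b" "x0 + a *\<^sub>R v \<in> frontier \<Omega>" "x0 + b *\<^sub>R v \<in> frontier \<Omega>" for a b
  proof -
    have "v \<noteq> 0" using that(3) frontier_notin assms(1) by auto
    then have "x0 \<noteq> x0 + b *\<^sub>R v" using that by simp
    moreover have "x0 + a *\<^sub>R v = (1 - a / b) *\<^sub>R x0 + (a / b) *\<^sub>R (x0 + b *\<^sub>R v)"
      using that by (simp add: algebra_simps)
    moreover have "0 < a / b" "a / b < 1" using that by simp_all
    ultimately have "x0 + a *\<^sub>R v \<in> open_segment x0 (x0 + b *\<^sub>R v)"
      unfolding in_segment by blast
    moreover have "x0 \<in> closure \<Omega>" using assms(1) closure_subset by blast
    ultimately show False
      using open_segment_subset[of x0 "x0 + b *\<^sub>R v"] that(3,4) frontier_closureD frontier_notin by blast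
  qed
  then show ?thesis using assms by (metis linorder_neqE)
qed

text \<open>Radial projection from an interior point maps the frontier homeomorphically onto the
  unit circle; its inverse composed with \<open>dir\<close> is the curve. For the orientation, the
  signed area of three points never vanishes on the convex set of ordered parameter triples within
  one turn, and it is positive for one triple.\<close>

lemma ex_boundary_curve: "\<exists>\<gamma>. boundary_curve \<Omega> \<gamma>"
proof -
  obtain x0 where x0: "x0 \<in> \<Omega>" using nonempty_dom by blast
  define \<phi> where "\<phi> = (\<lambda>s. (1 / norm (s - x0)) *\<^sub>R (s - x0))"
  have ne: "s \<noteq> x0" if "s \<in> frontier \<Omega>" for s using frontier_notin[OF that] x0 by blast
  have polar: "s = x0 + norm (s - x0) *\<^sub>R \<phi> s" if "s \<in> frontier \<Omega>" for s
    using ne[OF that] by (simp add: \<phi>_def)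
  have "continuous_on (frontier \<Omega>) \<phi>"
    unfolding \<phi>_def by (intro continuous_intros) (use ne in auto)
  moreover have "inj_on \<phi> (frontier \<Omega>)"
  proof (rule inj_onI)
    fix s t assume s: "s \<in> frontier \<Omega>" and t: "t \<in> frontier \<Omega>" and eq: "\<phi> s = \<phi> t"
    have "norm (s - x0) = norm (t - x0)"
      by (rule radial_unique[OF x0, of _ "\<phi> s"])
         (use s t polar[OF s] polar[OF t] ne eq in simp_all)
    then show "s = t" using polar[OF s] polar[OF t] eq by metis
  qed
  moreover have "\<phi> ` frontier \<Omega> = sphere 0 1"
  proof (intro set_eqI iffI)
    fix v assume "v \<in> \<phi> ` frontier \<Omega>"
    then show "v \<in> sphere 0 1" using ne by (auto simp: \<phi>_def)
  next
    fix v :: "real^2" assume v: "v \<in> sphere 0 1"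
    then have "v \<noteq> 0" by auto
    then obtain d where d: "0 < d" "x0 + d *\<^sub>R v \<in> frontier \<Omega>"
      using ray_to_frontier[OF bounded_dom, of x0 v] x0 v open_dom by (auto simp: interior_open)
    then have "v = \<phi> (x0 + d *\<^sub>R v)" using v by (simp add: \<phi>_def)
    then show "v \<in> \<phi> ` frontier \<Omega>" using d by blast
  qed
  ultimately obtain \<psi> where hom: "homeomorphism (frontier \<Omega>) (sphere 0 1) \<phi> \<psi>"
    using homeomorphism_compact[OF compact_frontier] by metis
  define \<gamma> where "\<gamma> t = \<psi> (dir t)" for t
  have fr: "\<gamma> t \<in> frontier \<Omega>" for t
    using hom by (auto simp: \<gamma>_def homeomorphism_def)
  have pg: "\<phi> (\<gamma> t) = dir t" for t
    using hom by (auto simp: \<gamma>_def homeomorphism_def)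
  have cont: "continuous_on S \<gamma>" for S
    unfolding \<gamma>_def
    by (rule continuous_on_compose2[OF homeomorphism_cont2[OF hom] continuous_on_dir]) auto
  have inj: "\<gamma> a \<noteq> \<gamma> b" if "a < b" "b < a + 2 * pi" for a b
    using dir_eqD[of a b] pg[of a] pg[of b] that by (metis not_le)
  define D where "D a b c = cross2 (\<gamma> b - \<gamma> a) (\<gamma> c - \<gamma> a)" for a b c
  \<comment> \<open>By strict convexity, three distinct frontier points are never collinear.\<close>
  have D0: "D a b c \<noteq> 0" if "a < b" "b < c" "c < a + 2 * pi" for a b c
  proof
    assume "D a b c = 0"
    then have "\<gamma> c \<in> closed_segment (\<gamma> a) (\<gamma> b)"
      using on_line_imp_on_segment[OF fr fr frontier_closureD[OF fr], of a b c] inj[of a b] that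
      by (simp add: D_def)
    then have "\<gamma> c = \<gamma> a \<or> \<gamma> c = \<gamma> b"
      using segment_frontier_endpoint[OF fr fr] frontier_notin[OF fr] by blast
    then show False using inj[of a c] inj[of b c] that by auto
  qed
  have D1: "D 0 (2 * pi / 3) (4 * pi / 3) > 0"
  proof -
    define \<rho> where "\<rho> t = norm (\<gamma> t - x0)" for t
    have \<rho>: "\<rho> t > 0" for t using ne[OF fr] by (simp add: \<rho>_def)
    have g: "\<gamma> t = x0 + \<rho> t *\<^sub>R dir t" for t using polar[OF fr, of t] by (simp add: pg \<rho>_def)
    \<comment> \<open>The area is split into three triangles with apex \<open>x0\<close>; for
      parameters a third of a turn apart all three sines are positive.\<close>
    have "D a b c = \<rho> a * \<rho> b * sin (b - a) + \<rho> b * \<rho> c * sin (c - b) + \<rho> c * \<rho> a * sin (a - c)" for a b c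
    proof -
      have "D a b c = cross2 (\<rho> b *\<^sub>R dir b - \<rho> a *\<^sub>R dir a) (\<rho> c *\<^sub>R dir c - \<rho> a *\<^sub>R dir a)"
        unfolding D_def g by simp
      then show ?thesis
        by (simp add: cross2_linear cross2_dir sin_diff) (simp add: algebra_simps)
    qed
    moreover have "sin (2 * pi / 3) > 0" by (intro sin_gt_zero) auto
    moreover have "sin (0 - 4 * pi / 3) = sin (2 * pi / 3)"
      using sin_periodic[of "- (4 * pi / 3)"] by (simp add: algebra_simps)
    ultimately show ?thesis using \<rho> by (simp add: add_pos_pos)
  qed
  \<comment> \<open>Strict inequalities survive convex combinations, so the path of triples in
    \<open>F\<close> below stays admissible.\<close>
  have mix: "(1 - s) * a + s * a' < (1 - s) * b + s * b'"
    if "a < b" "a' < b'" "0 \<le> s" "s \<le> 1" for a a' b b' s :: real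
  proof (cases "s = 1")
    case False
    then have "(1 - s) * a < (1 - s) * b" "s * a' \<le> s * b'"
      using that by (simp_all add: mult_left_mono)
    then show ?thesis by linarith
  qed (use that in simp)
  have pos: "D a b c > 0" if abc: "a < b" "b < c" "c < a + 2 * pi" for a b c
  proof (rule ccontr)
    assume neg: "\<not> D a b c > 0"
    define F where "F s = D ((1 - s) * a + s * 0) ((1 - s) * b + s * (2 * pi / 3)) ((1 - s) * c + s * (4 * pi / 3))" for s
    have "continuous_on {0..1} F"
      unfolding F_def D_def
      by (intro continuous_intros continuous_on_compose2[OF cont[of UNIV]]) auto
    moreover have "F 0 \<le> 0" "0 \<le> F 1" using neg D1 by (simp_all add: F_def)
    ultimately obtain s where s: "0 \<le> s" "s \<le> 1" "F s = 0"
      using IVT'[of F 0 0 1] by auto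
    have "(1 - s) * c + s * (4 * pi / 3) < (1 - s) * (a + 2 * pi) + s * (0 + 2 * pi)"
      by (rule mix) (use s abc in auto)
    then have "F s \<noteq> 0"
      unfolding F_def using s abc by (intro D0 mix) (auto simp: algebra_simps)
    then show False using s by simp
  qed
  have "boundary_curve \<Omega> \<gamma>"
  proof unfold_locales
    fix s assume s: "s \<in> frontier \<Omega>"
    have "norm (\<phi> s) = 1" using ne[OF s] by (simp add: \<phi>_def)
    then obtain t where t: "0 \<le> t" "t < 2 * pi" "\<phi> s = dir t" by (rule unit_vector_dir)
    then have "s = \<gamma> t" using hom s by (metis \<gamma>_def homeomorphism_apply1)
    then show "\<exists>t\<in>{0..<2 * pi}. s = \<gamma> t" using t by auto
  next
    show "\<gamma> (2 * pi) = \<gamma> 0" by (simp add: \<gamma>_def dir_def)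
  qed (use cont fr inj pos in \<open>auto simp: D_def\<close>)
  then show ?thesis by blast
qed

end

section \<open>Boundary arcs cut off by a chord\<close>

context boundary_curve
begin

lemma curve_inj_on: "inj_on \<gamma> {0..<2 * pi}"
proof (rule inj_onI)
  fix a b assume "a \<in> {0..<2 * pi}" "b \<in> {0..<2 * pi}" "\<gamma> a = \<gamma> b"
  then show "a = b" using curve_inj[of a b] curve_inj[of b a] by (cases a b rule: linorder_cases) auto
qed

text \<open>To the left of the chord lies the arc running counterclockwise from
  \<open>\<gamma> b\<close> to \<open>\<gamma> a\<close>. With growing \<open>t\<close> the
  indicator therefore falls by one at \<open>a\<close> and rises by one at \<open>b\<close>; the
  last summand is its value before both.\<close>

lemma curve_left_side:
  assumes "a \<in> {0..<2 * pi}" "b \<in> {0..<2 * pi}" "t \<in> {0..<2 * pi}" "t \<noteq> a" "t \<noteq> b" "a \<noteq> b"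
  shows "(of_bool (\<gamma> t \<in> left_side (\<gamma> a) (\<gamma> b)) :: int) = of_bool (b < t) - of_bool (a < t) + of_bool (a < b)"
proof -
  \<comment> \<open>The signed area of a triangle is invariant under cyclic permutations and changes
    sign under transpositions; this reduces every order of \<open>a\<close>, \<open>b\<close>,
    \<open>t\<close> to the increasing one.\<close>
  have rot: "cross2 (\<gamma> b - \<gamma> a) (\<gamma> t - \<gamma> a) = cross2 (\<gamma> a - \<gamma> t) (\<gamma> b - \<gamma> t)"
    "cross2 (\<gamma> b - \<gamma> a) (\<gamma> t - \<gamma> a) = cross2 (\<gamma> t - \<gamma> b) (\<gamma> a - \<gamma> b)"
    "cross2 (\<gamma> b - \<gamma> a) (\<gamma> t - \<gamma> a) = - cross2 (\<gamma> t - \<gamma> a) (\<gamma> b - \<gamma> a)"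
    "cross2 (\<gamma> b - \<gamma> a) (\<gamma> t - \<gamma> a) = - cross2 (\<gamma> b - \<gamma> t) (\<gamma> a - \<gamma> t)"
    "cross2 (\<gamma> b - \<gamma> a) (\<gamma> t - \<gamma> a) = - cross2 (\<gamma> a - \<gamma> b) (\<gamma> t - \<gamma> b)"
    by (simp_all add: cross2_def algebra_simps)
  consider "a < b" "b < t" | "a < t" "t < b" | "t < a" "a < b" | "b < a" "a < t" | "b < t" "t < a" | "t < b" "b < a"
    using assms(4-6) by linarith
  then show ?thesis
  proof cases
    case 1 then show ?thesis using curve_positive[of a b t] assms by (simp add: left_side_def)
  next
    case 2 then show ?thesis using curve_positive[of a t b] assms by (simp add: left_side_def rot(3))
  next
    case 3 then show ?thesis using curve_positive[of t a b] assms by (simp add: left_side_def rot(1))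
  next
    case 4 then show ?thesis using curve_positive[of b a t] assms by (simp add: left_side_def rot(5))
  next
    case 5 then show ?thesis using curve_positive[of b t a] assms by (simp add: left_side_def rot(2))
  next
    case 6 then show ?thesis using curve_positive[of t b a] assms by (simp add: left_side_def rot(4))
  qed
qed

end

text \<open>Take a bijection of least total length. Exchanging two partners is composition with a
  transposition, which gives another bijection and changes only two summands.\<close>

lemma minimal_pairing:
  fixes P :: "'i \<Rightarrow> 'a::metric_space"
  assumes "finite A" "finite B" "card A = card B"
  obtains \<sigma> where "bij_betw \<sigma> A B"
    "\<And>i j. i \<in> A \<Longrightarrow> j \<in> A \<Longrightarrow>
       dist (P i) (P (\<sigma> i)) + dist (P j) (P (\<sigma> j)) \<le> dist (P i) (P (\<sigma> j)) + dist (P j) (P (\<sigma> i))"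
proof -
  \<comment> \<open>Extensionality outside \<open>A\<close> makes the set of candidates
    finite.\<close>
  define S where "S = {\<sigma> \<in> A \<rightarrow>\<^sub>E B. bij_betw \<sigma> A B}"
  define cost where "cost \<sigma> = (\<Sum>i\<in>A. dist (P i) (P (\<sigma> i)))" for \<sigma>
  have "finite S" unfolding S_def using assms by (simp add: finite_PiE)
  moreover obtain f where f: "bij_betw f A B" using finite_same_card_bij[OF assms] by blast
  then have "bij_betw (restrict f A) A B" by (simp cong: bij_betw_cong)
  then have "restrict f A \<in> S" unfolding S_def using f by (auto simp: bij_betw_def)
  then have "S \<noteq> {}" by blast
  ultimately obtain \<sigma> where \<sigma>: "\<sigma> \<in> S" "\<And>\<tau>. \<tau> \<in> S \<Longrightarrow> cost \<sigma> \<le> cost \<tau>"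
    using ex_is_arg_min_if_finite[of S cost] by (auto simp: is_arg_min_linorder)
  show ?thesis
  proof (rule that)
    show bij: "bij_betw \<sigma> A B" using \<sigma>(1) by (simp add: S_def)
    fix i j assume i: "i \<in> A" and j: "j \<in> A"
    show "dist (P i) (P (\<sigma> i)) + dist (P j) (P (\<sigma> j)) \<le> dist (P i) (P (\<sigma> j)) + dist (P j) (P (\<sigma> i))"
    proof (cases "i = j")
      case False
      define \<tau> where "\<tau> = \<sigma>(i := \<sigma> j, j := \<sigma> i)"
      have "\<tau> = \<sigma> \<circ> Transposition.transpose i j" by (auto simp: \<tau>_def Transposition.transpose_def fun_eq_iff)
      moreover have "bij_betw (Transposition.transpose i j) A A"
        by (rule bij_betw_byWitness[where f' = "Transposition.transpose i j"])
           (use i j in \<open>auto simp: Transposition.transpose_def\<close>)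
      ultimately have "bij_betw \<tau> A B" using bij by (metis bij_betw_trans)
      moreover have "\<tau> \<in> A \<rightarrow>\<^sub>E B" using \<sigma>(1) i j by (auto simp: \<tau>_def S_def PiE_def extensional_def Pi_def)
      ultimately have le: "cost \<sigma> \<le> cost \<tau>" using \<sigma>(2) by (simp add: S_def)
      have split: "cost \<upsilon> = dist (P i) (P (\<upsilon> i)) + (dist (P j) (P (\<upsilon> j)) + (\<Sum>k\<in>A - {i} - {j}. dist (P k) (P (\<upsilon> k))))" for \<upsilon>
        unfolding cost_def using assms(1) i j False
        by (simp add: sum.remove[of A i] sum.remove[of "A - {i}" j])
      have "(\<Sum>k\<in>A - {i} - {j}. dist (P k) (P (\<tau> k))) = (\<Sum>k\<in>A - {i} - {j}. dist (P k) (P (\<sigma> k)))"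
        by (intro sum.cong) (auto simp: \<tau>_def)
      then show ?thesis using le False unfolding split by (simp add: \<tau>_def)
    qed simp
  qed
qed

context boundary_curve
begin

text \<open>Sample \<open>N * g\<close> along the curve so finely that integer parts at neighbouring
  points differ by at most one. Over a full turn the jumps cancel, so as many go down as up. By
  \<open>curve_left_side\<close>, chords from downward to upward jumps make the height follow the
  integer parts up to a constant.\<close>

lemma ex_chord_family:
  assumes g: "continuous_on (frontier \<Omega>) g" and N: "N > (0::nat)"
  shows "\<exists>A (p :: nat \<Rightarrow> real^2) q c. chord_family \<Omega> A p q \<and>
    (\<forall>s\<in>frontier \<Omega>. \<bar>(c + real (chord_family.height A p q s)) / N - g s\<bar> \<le> 3 / N)"
proof -
  define h where "h t = N * g (\<gamma> t)" for t
  have "continuous_on {0..2 * pi} h"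
    unfolding h_def
    by (intro continuous_intros continuous_on_compose2[OF g] continuous_on_subset[OF cont_curve])
       (auto simp: curve_frontier)
  then have "uniformly_continuous_on {0..2 * pi} h"
    by (simp add: compact_uniformly_continuous)
  then obtain d where d: "d > 0"
    "\<And>s t. s \<in> {0..2 * pi} \<Longrightarrow> t \<in> {0..2 * pi} \<Longrightarrow> \<bar>s - t\<bar> < d \<Longrightarrow> \<bar>h s - h t\<bar> < 1"
    unfolding uniformly_continuous_on_def dist_real_def by (metis zero_less_one)
  \<comment> \<open>Chosen so that the mesh \<open>2 * pi / M\<close> is below the modulus
    \<open>d\<close>.\<close>
  obtain M :: nat where M: "2 * pi / d < M" using reals_Archimedean2 by blast
  have "0 < 2 * pi / d" using d(1) by simp
  then have M0: "0 < real M" using M by linarith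
  have Md: "2 * pi / M < d" using M M0 d(1) by (simp add: field_simps)
  define \<theta> where "\<theta> k = 2 * pi * real k / M" for k :: nat
  have \<theta>_less: "\<theta> k < \<theta> l \<longleftrightarrow> k < l" for k l
    using M0 by (simp add: \<theta>_def divide_less_cancel)
  have \<theta>_eq: "\<theta> k = \<theta> l \<longleftrightarrow> k = l" for k l
    using M0 by (simp add: \<theta>_def)
  have \<theta>_M: "\<theta> M = 2 * pi" and \<theta>_0: "\<theta> 0 = 0" using M0 by (simp_all add: \<theta>_def)
  have \<theta>_ivl: "\<theta> k \<in> {0..<2 * pi}" if "k < M" for k
    using \<theta>_less[of k M] that \<theta>_M by (simp add: \<theta>_def)
  have \<theta>_cl: "\<theta> k \<in> {0..2 * pi}" if "k \<le> M" for k
    using \<theta>_ivl[of k] \<theta>_M that by (cases "k = M") auto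
  define G where "G k = \<lfloor>h (\<theta> k)\<rfloor>" for k
  define D where "D k = G (Suc k) - G k" for k
  have GM: "G M = G 0" by (simp add: G_def \<theta>_M \<theta>_0 h_def curve_periodic)
  have D: "D k \<in> {-1, 0, 1}" if "k < M" for k
  proof -
    have "\<theta> (Suc k) - \<theta> k = 2 * pi / M" by (simp add: \<theta>_def add_divide_distrib algebra_simps)
    then have "\<bar>h (\<theta> (Suc k)) - h (\<theta> k)\<bar> < 1"
      using that M0 Md by (intro d(2) \<theta>_cl) auto
    then show ?thesis unfolding D_def G_def by auto linarith
  qed
  define A where "A = {k \<in> {..<M}. D k = -1}"
  define B where "B = {k \<in> {..<M}. D k = 1}"
  have fin: "finite A" "finite B" and AB: "A \<inter> B = {}"
    and AM: "\<And>k. k \<in> A \<Longrightarrow> k < M" and BM: "\<And>k. k \<in> B \<Longrightarrow> k < M"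
    by (auto simp: A_def B_def)
  have Dsum: "(\<Sum>k<M. D k * f k) = (\<Sum>k\<in>B. f k) - (\<Sum>k\<in>A. f k)" for f :: "nat \<Rightarrow> int"
  proof -
    have "(\<Sum>k<M. D k * f k) = (\<Sum>k<M. (if D k = 1 then f k else 0) - (if D k = -1 then f k else 0))"
      using D by (intro sum.cong) auto
    also have "\<dots> = (\<Sum>k\<in>B. f k) - (\<Sum>k\<in>A. f k)"
      unfolding A_def B_def by (simp only: sum_subtractf sum.inter_filter[OF finite_lessThan])
    finally show ?thesis .
  qed
  have tele: "(\<Sum>k<m. D k) = G m - G 0" for m
    unfolding D_def by (simp add: sum_lessThan_telescope)
  have "card A = card B" using Dsum[of "\<lambda>_. 1"] tele[of M] GM by simp
  from minimal_pairing[OF fin this, of "\<lambda>k. \<gamma> (\<theta> k)"]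
  obtain \<sigma> where bij: "bij_betw \<sigma> A B" and min: "\<And>i j. i \<in> A \<Longrightarrow> j \<in> A \<Longrightarrow>
       dist (\<gamma> (\<theta> i)) (\<gamma> (\<theta> (\<sigma> i))) + dist (\<gamma> (\<theta> j)) (\<gamma> (\<theta> (\<sigma> j)))
       \<le> dist (\<gamma> (\<theta> i)) (\<gamma> (\<theta> (\<sigma> j))) + dist (\<gamma> (\<theta> j)) (\<gamma> (\<theta> (\<sigma> i)))" by blast
  define p where "p k = \<gamma> (\<theta> k)" for k
  define q where "q k = \<gamma> (\<theta> (\<sigma> k))" for k
  have p_eq: "p k = p l \<longleftrightarrow> k = l" if "k < M" "l < M" for k l
    unfolding p_def using inj_on_eq_iff[OF curve_inj_on \<theta>_ivl[OF that(1)] \<theta>_ivl[OF that(2)]] \<theta>_eq by simp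
  have q: "q k = p (\<sigma> k)" for k by (simp add: p_def q_def)
  have \<sigma>B: "\<sigma> k \<in> B" if "k \<in> A" for k using bij that by (auto simp: bij_betw_def)
  have \<sigma>_inj: "\<sigma> k = \<sigma> l \<longleftrightarrow> k = l" if "k \<in> A" "l \<in> A" for k l
    using bij that by (auto simp: bij_betw_def inj_on_def)
  have fam: "chord_family \<Omega> A p q"
  proof unfold_locales
    show "inj_on p A" using AM by (auto simp: inj_on_def p_eq)
    show "inj_on q A" using BM \<sigma>B by (auto simp: inj_on_def q p_eq \<sigma>_inj)
    fix i j assume "i \<in> A" "j \<in> A"
    then show "p i \<noteq> q j" using AM BM \<sigma>B[of j] AB p_eq[of i "\<sigma> j"] by (auto simp: q)
    show "dist (p i) (q i) + dist (p j) (q j) \<le> dist (p i) (q j) + dist (p j) (q i)"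
      unfolding p_def q_def using \<open>i \<in> A\<close> \<open>j \<in> A\<close> by (rule min)
  qed (use fin curve_frontier in \<open>simp_all add: p_def q_def\<close>)
  \<comment> \<open>The constant terms contributed by \<open>curve_left_side\<close>, to be
    subtracted again.\<close>
  define c0 where "c0 = (\<Sum>k\<in>A. of_bool (\<theta> k < \<theta> (\<sigma> k)) :: int)"
  \<comment> \<open>The error 3 is made up of one for a chord ending at \<open>\<gamma> t\<close>,
    one for the integer part, and one for moving from \<open>t\<close> to a sample point.\<close>
  have est: "\<bar>real_of_int (G 0 - c0) + real (chord_family.height A p q (\<gamma> t)) - h t\<bar> \<le> 3"
    if t: "t \<in> {0..<2 * pi}" for t
  proof -
    define E where "E k = (of_bool (\<theta> (\<sigma> k) < t) - of_bool (\<theta> k < t) + of_bool (\<theta> k < \<theta> (\<sigma> k)) :: int)" for k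
    define F where "F k = (of_bool (\<gamma> t \<in> left_side (p k) (q k)) :: int)" for k
    \<comment> \<open>Chord ends are outside the scope of \<open>curve_left_side\<close>; as all
      ends are distinct, at most one chord is affected.\<close>
    define bad where "bad = {k \<in> A. t = \<theta> k \<or> t = \<theta> (\<sigma> k)}"
    have FE: "F k = E k" if "k \<in> A" "k \<notin> bad" for k
      unfolding F_def E_def p_def q_def
      by (rule curve_left_side) (use that \<theta>_ivl AM BM \<sigma>B[of k] AB t \<theta>_eq in \<open>auto simp: bad_def\<close>)
    have "card bad \<le> 1"
    proof -
      have "k = l" if "k \<in> bad" "l \<in> bad" for k l
        using that \<sigma>_inj[of k l] \<sigma>B[of k] \<sigma>B[of l] AB by (auto simp: bad_def \<theta>_eq)
      moreover have "finite bad" using fin by (simp add: bad_def)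
      ultimately have "card bad \<le> Suc 0" using card_le_Suc0_iff_eq by blast
      then show ?thesis by simp
    qed
    have "\<bar>(\<Sum>k\<in>A. F k) - (\<Sum>k\<in>A. E k)\<bar> \<le> (\<Sum>k\<in>A. \<bar>F k - E k\<bar>)"
      by (simp add: sum_abs flip: sum_subtractf)
    also have "\<dots> = (\<Sum>k\<in>bad. \<bar>F k - E k\<bar>)"
      using fin FE by (intro sum.mono_neutral_right) (auto simp: bad_def)
    also have "\<dots> \<le> (\<Sum>k\<in>bad. 1)"
      by (intro sum_mono) (auto simp: F_def E_def)
    also have "\<dots> \<le> 1" using \<open>card bad \<le> 1\<close> by simp
    finally have 1: "\<bar>(\<Sum>k\<in>A. F k) - (\<Sum>k\<in>A. E k)\<bar> \<le> 1" .
    have ht: "int (chord_family.height A p q (\<gamma> t)) = (\<Sum>k\<in>A. F k)"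
      unfolding chord_family.height_def[OF fam] F_def using fin
      by (simp add: Int_def)
    \<comment> \<open>The number of sample points before \<open>t\<close>. The jump from sample
      \<open>k\<close> to \<open>Suc k\<close> is placed at \<open>\<theta> k\<close>, so the jumps
      before \<open>t\<close> are those with \<open>k < m\<close> and telescope to
      \<open>G m - G 0\<close>; \<open>\<theta> m\<close> is the first sample point at or after
      \<open>t\<close>.\<close>
    define m where "m = nat \<lceil>t * M / (2 * pi)\<rceil>"
    have "\<theta> k < t \<longleftrightarrow> real k < t * M / (2 * pi)" for k
      using M0 by (simp add: \<theta>_def field_simps)
    then have km: "\<theta> k < t \<longleftrightarrow> k < m" for k
      unfolding m_def by (simp add: zless_nat_eq_int_zless less_ceiling_iff)
    have mM: "m \<le> M" using km[of M] t \<theta>_M by auto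
    have "(\<Sum>k\<in>A. E k) = (\<Sum>k\<in>A. of_bool (\<theta> (\<sigma> k) < t)) - (\<Sum>k\<in>A. of_bool (\<theta> k < t)) + c0"
      unfolding E_def c0_def by (simp only: sum.distrib sum_subtractf)
    also have "(\<Sum>k\<in>A. of_bool (\<theta> (\<sigma> k) < t)) = (\<Sum>k\<in>B. of_bool (\<theta> k < t) :: int)"
      by (rule sum.reindex_bij_betw[OF bij])
    also have "(\<Sum>k\<in>B. of_bool (\<theta> k < t)) - (\<Sum>k\<in>A. of_bool (\<theta> k < t) :: int) = (\<Sum>k<M. D k * of_bool (k < m))"
      by (simp add: Dsum km)
    also have "\<dots> = (\<Sum>k<m. D k)"
      using mM by (intro sum.mono_neutral_cong_right) auto
    finally have 2: "(\<Sum>k\<in>A. E k) = G m - G 0 + c0" by (simp add: tele)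
    have "\<bar>t - \<theta> m\<bar> < d"
    proof (cases m)
      case 0
      then show ?thesis using km[of 0] t d(1) by (simp add: \<theta>_0)
    next
      case (Suc n)
      then have "\<theta> n < t" "t \<le> \<theta> m" using km[of n] km[of m] by auto
      moreover have "\<theta> m - \<theta> n = 2 * pi / M" by (simp add: \<theta>_def Suc add_divide_distrib algebra_simps)
      ultimately show ?thesis using Md by linarith
    qed
    then have "\<bar>h t - h (\<theta> m)\<bar> < 1"
      using t \<theta>_cl[OF mM] by (intro d(2)) auto
    moreover have "\<bar>G m - h (\<theta> m)\<bar> \<le> 1" unfolding G_def by linarith
    moreover have "real (chord_family.height A p q (\<gamma> t)) = real_of_int (\<Sum>k\<in>A. F k)"
      by (metis ht of_int_of_nat_eq)
    moreover have "\<bar>real_of_int (\<Sum>k\<in>A. F k) - real_of_int (G m - G 0 + c0)\<bar> \<le> 1"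
      using 1 unfolding 2 by linarith
    ultimately show ?thesis by simp
  qed
  have "\<bar>(real_of_int (G 0 - c0) + real (chord_family.height A p q s)) / N - g s\<bar> \<le> 3 / N"
    if s: "s \<in> frontier \<Omega>" for s
  proof -
    obtain t where t: "t \<in> {0..<2 * pi}" "s = \<gamma> t" using curve_surj[OF s] by blast
    have "\<bar>(real_of_int (G 0 - c0) + real (chord_family.height A p q s)) / N - g s\<bar>
        = \<bar>real_of_int (G 0 - c0) + real (chord_family.height A p q s) - h t\<bar> / N"
      using N by (simp add: h_def t(2) field_simps)
    also have "\<dots> \<le> 3 / N" using est[OF t(1)] t(2) by (intro divide_right_mono) auto
    finally show ?thesis .
  qed
  with fam show ?thesis by blast
qed

end

section \<open>Passage to the limit\<close>

context chord_family
begin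

text \<open>Walking from each of \<open>x\<close> and \<open>y\<close> towards the other up to the
  first chord costs \<open>1 / N\<close> each. These chords come within \<open>d\<close> of each
  other, so their starts or their ends are close. The function is constant along each chord and
  within \<open>3 / N\<close> of \<open>g\<close> at its ends, which gives
  \<open>e + 2 / N + 6 / N\<close>.\<close>

lemma height_equicontinuous:
  fixes g :: "real^2 \<Rightarrow> real"
  assumes approx: "\<And>s. s \<in> frontier \<Omega> \<Longrightarrow> \<bar>(c + real (height s)) / N - g s\<bar> \<le> 3 / N" and N: "N > 0"
    and near: "\<And>p q p' q' z z'. \<lbrakk>p \<in> frontier \<Omega>; q \<in> frontier \<Omega>; p' \<in> frontier \<Omega>; q' \<in> frontier \<Omega>;
       z \<in> closed_segment p q; z' \<in> closed_segment p' q'; dist z z' < d;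
       dist p q + dist p' q' \<le> dist p q' + dist p' q\<rbrakk> \<Longrightarrow> dist p p' < d' \<or> dist q q' < d'"
    and g: "\<And>s s'. s \<in> frontier \<Omega> \<Longrightarrow> s' \<in> frontier \<Omega> \<Longrightarrow> dist s s' < d' \<Longrightarrow> \<bar>g s - g s'\<bar> \<le> e"
    and x: "x \<in> closure \<Omega>" and y: "y \<in> closure \<Omega>" and xy: "dist x y < d" and e: "e \<ge> 0"
  shows "\<bar>(c + real (height x)) / N - (c + real (height y)) / N\<bar> \<le> e + 8 / N"
proof (cases "height x = height y")
  case True
  then show ?thesis using e N by simp
next
  case False
  define U where "U x = (c + real (height x)) / N" for x
  have step: "\<bar>U w - U z\<bar> \<le> 1 / N" if "\<bar>real (height w) - real (height z)\<bar> \<le> 1" for w z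
  proof -
    have "\<bar>U w - U z\<bar> = \<bar>real (height w) - real (height z)\<bar> / N"
      using N by (simp add: U_def abs_divide flip: diff_divide_distrib)
    also have "\<dots> \<le> 1 / N" using that N by (intro divide_right_mono) auto
    finally show ?thesis .
  qed
  have sum8: "8 / N = 1 / N + 1 / N + 3 / N + 3 / N" by (simp add: field_simps)
  obtain i z where i: "i \<in> A" "z \<in> chord i" "z \<in> closed_segment x y"
    "\<bar>real (height x) - real (height z)\<bar> \<le> 1"
    using height_first_chord[OF x y False] by metis
  obtain j z' where j: "j \<in> A" "z' \<in> chord j" "z' \<in> closed_segment y x"
    "\<bar>real (height y) - real (height z')\<bar> \<le> 1"
    using height_first_chord[OF y x] False by metis
  have "dist z z' \<le> dist x y"
  proof -
    obtain s where s: "z = (1 - s) *\<^sub>R x + s *\<^sub>R y" "0 \<le> s" "s \<le> 1"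
      using i(3) by (auto simp: in_segment)
    obtain t where t: "z' = (1 - t) *\<^sub>R y + t *\<^sub>R x" "0 \<le> t" "t \<le> 1"
      using j(3) by (auto simp: in_segment)
    have "z - z' = (1 - s - t) *\<^sub>R (x - y)" unfolding s t by (simp add: algebra_simps)
    moreover have "\<bar>1 - s - t\<bar> \<le> 1" using s t by linarith
    ultimately show ?thesis by (simp add: dist_norm mult_left_le_one_le)
  qed
  then have "dist z z' < d" using xy by simp
  then have near: "dist (p i) (p j) < d' \<or> dist (q i) (q j) < d'"
    using near[OF _ _ _ _ i(2) j(2)] p_frontier q_frontier i j minimal by blast
  have "\<bar>U z - U z'\<bar> \<le> e + 3 / N + 3 / N"
    using near
  proof
    assume "dist (p i) (p j) < d'"
    then have "\<bar>g (p i) - g (p j)\<bar> \<le> e" using g p_frontier i j by blast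
    moreover have "U z = U (p i)" "U z' = U (p j)"
      using height_constant_on_chord[OF i(1,2)] height_constant_on_chord[OF j(1,2)] by (simp_all add: U_def)
    moreover have "\<bar>U (p i) - g (p i)\<bar> \<le> 3 / N" "\<bar>U (p j) - g (p j)\<bar> \<le> 3 / N"
      unfolding U_def using approx p_frontier i j by blast+
    ultimately show ?thesis by linarith
  next
    assume "dist (q i) (q j) < d'"
    then have "\<bar>g (q i) - g (q j)\<bar> \<le> e" using g q_frontier i j by blast
    moreover have "U z = U (q i)" "U z' = U (q j)"
      using height_constant_on_chord[OF i(1,2)] height_constant_on_chord[OF j(1,2)] by (simp_all add: U_def)
    moreover have "\<bar>U (q i) - g (q i)\<bar> \<le> 3 / N" "\<bar>U (q j) - g (q j)\<bar> \<le> 3 / N"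
      unfolding U_def using approx q_frontier i j by blast+
    ultimately show ?thesis by linarith
  qed
  then show ?thesis
    using step[OF i(4)] step[OF j(4)] unfolding sum8 U_def[symmetric] by linarith
qed

text \<open>The first chord on the way from \<open>x\<close> to a frontier point carries a boundary
  value, bounded by \<open>b + 3\<close>, to within \<open>1 / N\<close> of the value at
  \<open>x\<close>.\<close>

lemma height_bounded:
  fixes g :: "real^2 \<Rightarrow> real"
  assumes approx: "\<And>s. s \<in> frontier \<Omega> \<Longrightarrow> \<bar>(c + real (height s)) / N - g s\<bar> \<le> 3 / N" and N: "N \<ge> 1"
    and g: "\<And>s. s \<in> frontier \<Omega> \<Longrightarrow> \<bar>g s\<bar> \<le> b"
    and x: "x \<in> closure \<Omega>" and ne: "frontier \<Omega> \<noteq> {}"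
  shows "\<bar>(c + real (height x)) / N\<bar> \<le> b + 4"
proof -
  have "3 / N \<le> 3" "1 / N \<le> 1" using N by (simp_all add: field_simps)
  then have fr: "\<bar>(c + real (height s)) / N\<bar> \<le> b + 3" if "s \<in> frontier \<Omega>" for s
    using approx[OF that] g[OF that] by linarith
  obtain s where s: "s \<in> frontier \<Omega>" using ne by blast
  show ?thesis
  proof (cases "height x = height s")
    case True
    then show ?thesis using fr[OF s] by simp
  next
    case False
    obtain i z where i: "i \<in> A" "z \<in> chord i" "\<bar>real (height x) - real (height z)\<bar> \<le> 1"
      using height_first_chord[OF x frontier_closureD[OF s] False] by metis
    have "height z = height (p i)" using height_constant_on_chord[OF i(1,2)] by simp
    then have "\<bar>(c + real (height z)) / N\<bar> \<le> b + 3" using fr[OF p_frontier[OF i(1)]] by simp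
    moreover have "\<bar>(c + real (height x)) / N - (c + real (height z)) / N\<bar> = \<bar>real (height x) - real (height z)\<bar> / N"
      using N by (simp add: abs_divide flip: diff_divide_distrib)
    moreover have "\<bar>real (height x) - real (height z)\<bar> / N \<le> 1 / N"
      using i(3) N by (intro divide_right_mono) auto
    ultimately show ?thesis using \<open>1 / N \<le> 1\<close> by linarith
  qed
qed

end

text \<open>Along a subsequence the directions converge to some \<open>w0\<close>. A point strictly
  to the left of \<open>w0\<close> is eventually to the left of these directions; a point on the
  edge of the half disc is a limit of such points, and \<open>v\<close> is continuous.\<close>

lemma half_disc_property_limit:
  assumes "\<And>n. half_disc_property (U n) x r"
    and lim: "\<And>y. y \<in> ball x r \<Longrightarrow> (\<lambda>n. U n y) \<longlonglongrightarrow> v y"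
    and cont: "continuous_on (ball x r) v" and r: "r > 0"
  shows "half_disc_property v x r"
proof -
  obtain w where w: "\<And>n. norm (w n) = 1"
    "\<And>n y. y \<in> ball x r \<Longrightarrow> 0 \<le> cross2 (w n) (y - x) \<Longrightarrow> U n x \<le> U n y"
    using assms(1) unfolding half_disc_property_def by metis
  have "seq_compact (sphere (0 :: real^2) 1)" by (simp add: compact_eq_seq_compact_metric[symmetric])
  then obtain w0 j where w0: "w0 \<in> sphere 0 1" and j: "strict_mono (j :: nat \<Rightarrow> nat)" "(w \<circ> j) \<longlonglongrightarrow> w0"
    by (rule seq_compactE[where f = w]) (use w(1) in auto)
  have pos: "v x \<le> v y" if y: "y \<in> ball x r" and c: "0 < cross2 w0 (y - x)" for y
  proof -
    have "(\<lambda>n. cross2 (w (j n)) (y - x)) \<longlonglongrightarrow> cross2 w0 (y - x)"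
      using j(2) by (intro tendsto_intros) (simp add: o_def)
    then have "\<forall>\<^sub>F n in sequentially. 0 < cross2 (w (j n)) (y - x)"
      using c by (simp add: order_tendstoD(1))
    then have ev: "\<forall>\<^sub>F n in sequentially. U (j n) x \<le> U (j n) y"
      by (rule eventually_mono) (use w(2)[OF y] in auto)
    have "(\<lambda>n. U (j n) z) \<longlonglongrightarrow> v z" if "z \<in> ball x r" for z
      using LIMSEQ_subseq_LIMSEQ[OF lim[OF that] j(1)] by (simp add: o_def)
    from tendsto_le[OF sequentially_bot this[OF y] this[of x] ev] show ?thesis
      using r by simp
  qed
  have "v x \<le> v y" if y: "y \<in> ball x r" and c: "0 \<le> cross2 w0 (y - x)" for y
  proof -
    \<comment> \<open>\<open>w0\<close> turned left by a right angle; adding small multiples of it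
      moves \<open>y\<close> strictly off the edge.\<close>
    define n :: "real^2" where "n = vector [- w0$2, w0$1]"
    have n: "cross2 w0 n = 1"
      using w0 by (simp add: n_def cross2_def norm_eq_1 inner_vec_def sum_2)
    let ?y = "\<lambda>m. y + (1 / Suc m) *\<^sub>R n"
    have "(\<lambda>m. 1 / Suc m) \<longlonglongrightarrow> 0" by (rule LIMSEQ_Suc[OF lim_1_over_n])
    from tendsto_add[OF tendsto_const[of y] tendsto_scaleR[OF this tendsto_const[of n]]]
    have ty: "?y \<longlonglongrightarrow> y" by simp
    then have ev: "\<forall>\<^sub>F m in sequentially. ?y m \<in> ball x r"
      using y by (metis open_ball topological_tendstoD)
    have "isCont v y" using cont y by (simp add: continuous_on_eq_continuous_at)
    then have lv: "(\<lambda>m. v (?y m)) \<longlonglongrightarrow> v y" using ty by (rule isCont_tendsto_compose)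
    have "v x \<le> v (?y m)" if "?y m \<in> ball x r" for m
    proof (rule pos[OF that])
      have "cross2 w0 (?y m - x) = cross2 w0 (y - x) + 1 / Suc m"
        using n by (simp add: cross2_linear)
      moreover have "0 < 1 / real (Suc m)" by simp
      ultimately show "0 < cross2 w0 (?y m - x)" using c by linarith
    qed
    then have "\<forall>\<^sub>F m in sequentially. v x \<le> v (?y m)"
      using ev by (auto elim: eventually_mono)
    then show ?thesis using tendsto_lowerbound[OF lv] by simp
  qed
  then show ?thesis unfolding half_disc_property_def using w0 by auto
qed

text \<open>The Arzela-Ascoli argument for functions with small jumps. A diagonal subsequence
  converges on a countable dense set; comparison with near-by points extends this to
  \<open>S\<close>, since the error \<open>c / Suc n\<close> vanishes along the subsequence, and the
  limit is continuous for the same reason.\<close>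

lemma asymptotically_equicontinuous_subsequence:
  fixes U :: "nat \<Rightarrow> 'a::euclidean_space \<Rightarrow> real"
  assumes bd: "\<And>n x. x \<in> S \<Longrightarrow> \<bar>U n x\<bar> \<le> b"
    and equi: "\<And>e. e > 0 \<Longrightarrow> \<exists>d>0. \<forall>n. \<forall>x\<in>S. \<forall>y\<in>S. dist x y < d \<longrightarrow> \<bar>U n x - U n y\<bar> \<le> e + c / Suc n"
  shows "\<exists>k v. strict_mono (k :: nat \<Rightarrow> nat) \<and> continuous_on S v \<and>
    (\<forall>x\<in>S. (\<lambda>n. U (k n) x) \<longlonglongrightarrow> v x)"
proof -
  obtain T where T: "countable T" "T \<subseteq> S" "S \<subseteq> closure T" by (rule separable)
  obtain k where k: "strict_mono (k :: nat \<Rightarrow> nat)"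
    and kT: "\<And>x. x \<in> T \<Longrightarrow> \<exists>l. (\<lambda>n. U (k n) x) \<longlonglongrightarrow> l"
    using function_convergent_subsequence[OF T(1), of U b] bd T(2) by (metis real_norm_def subsetD)
  have "(\<lambda>n. c / Suc n) \<longlonglongrightarrow> 0"
    by (rule LIMSEQ_Suc[OF lim_const_over_n])
  from LIMSEQ_subseq_LIMSEQ[OF this k] have ck: "(\<lambda>n. c / Suc (k n)) \<longlonglongrightarrow> 0" by (simp add: o_def)
  have "convergent (\<lambda>n. U (k n) x)" if x: "x \<in> S" for x
  proof (rule Cauchy_convergent, rule metric_CauchyI)
    fix e :: real assume e: "e > 0"
    then obtain d where d: "d > 0" "\<And>n y. y \<in> S \<Longrightarrow> dist x y < d \<Longrightarrow> \<bar>U n x - U n y\<bar> \<le> e / 8 + c / Suc n"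
      using equi[of "e / 8"] x by auto
    obtain y where y: "y \<in> T" "dist y x < d"
      using T(3) x d(1) by (meson closure_approachable subsetD)
    have "Cauchy (\<lambda>n. U (k n) y)" using kT[OF y(1)] by (auto intro: LIMSEQ_imp_Cauchy)
    then obtain M1 where M1: "\<And>m n. m \<ge> M1 \<Longrightarrow> n \<ge> M1 \<Longrightarrow> \<bar>U (k m) y - U (k n) y\<bar> < e / 8"
      using e unfolding Cauchy_def dist_real_def by (metis divide_pos_pos zero_less_numeral)
    obtain M2 where M2: "\<And>n. n \<ge> M2 \<Longrightarrow> c / Suc (k n) < e / 8"
      using order_tendstoD(2)[OF ck, of "e / 8"] e by (auto simp: eventually_sequentially)
    have xy: "\<bar>U (k n) x - U (k n) y\<bar> \<le> e / 8 + c / Suc (k n)" for n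
      using d(2)[of y "k n"] y T(2) by (auto simp: dist_commute)
    show "\<exists>M. \<forall>m\<ge>M. \<forall>n\<ge>M. dist (U (k m) x) (U (k n) x) < e"
    proof (intro exI allI impI)
      fix m n assume "m \<ge> max M1 M2" "n \<ge> max M1 M2"
      then have "\<bar>U (k m) y - U (k n) y\<bar> < e / 8" "c / Suc (k m) < e / 8" "c / Suc (k n) < e / 8"
        using M1 M2 by simp_all
      then show "dist (U (k m) x) (U (k n) x) < e"
        using xy[of m] xy[of n] e unfolding dist_real_def by linarith
    qed
  qed
  then have lim: "(\<lambda>n. U (k n) x) \<longlonglongrightarrow> lim (\<lambda>n. U (k n) x)" if "x \<in> S" for x
    using that by (simp add: convergent_LIMSEQ_iff)
  have "continuous_on S (\<lambda>x. lim (\<lambda>n. U (k n) x))"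
    unfolding continuous_on_iff
  proof (intro ballI allI impI)
    fix x and e :: real assume x: "x \<in> S" and e: "e > 0"
    obtain d where d: "d > 0" "\<And>n y. y \<in> S \<Longrightarrow> dist x y < d \<Longrightarrow> \<bar>U n x - U n y\<bar> \<le> e / 2 + c / Suc n"
      using equi[of "e / 2"] e x by auto
    have "dist (lim (\<lambda>n. U (k n) y)) (lim (\<lambda>n. U (k n) x)) < e" if y: "y \<in> S" "dist y x < d" for y
    proof -
      have "(\<lambda>n. \<bar>U (k n) x - U (k n) y\<bar>) \<longlonglongrightarrow> \<bar>lim (\<lambda>n. U (k n) x) - lim (\<lambda>n. U (k n) y)\<bar>"
        using lim x y by (intro tendsto_intros)
      moreover have "(\<lambda>n. e / 2 + c / Suc (k n)) \<longlonglongrightarrow> e / 2 + 0"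
        by (intro tendsto_intros ck)
      ultimately have "\<bar>lim (\<lambda>n. U (k n) x) - lim (\<lambda>n. U (k n) y)\<bar> \<le> e / 2 + 0"
        by (rule LIMSEQ_le) (use d(2) y in \<open>auto simp: dist_commute\<close>)
      then show ?thesis using e by (simp add: dist_real_def abs_minus_commute)
    qed
    then show "\<exists>d>0. \<forall>y\<in>S. dist y x < d \<longrightarrow> dist (lim (\<lambda>n. U (k n) y)) (lim (\<lambda>n. U (k n) x)) < e"
      using d(1) by blast
  qed
  then show ?thesis using k lim by blast
qed

section \<open>Half circles and medians\<close>

lemma emeasure_arclength_half_circle:
  assumes r: "r > 0"
  shows "ennreal (pi * r) \<le> emeasure (arclength x r) {s \<in> sphere x r. 0 \<le> cross2 w (s - x)}"
proof -
  define k where "k t = cross2 w (dir (t / r))" for t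
  define X where "X = {t \<in> {0..<pi * r}. 0 \<le> k t}"
  define X' where "X' = {t \<in> {0..<pi * r}. k t \<le> 0}"
  define Y where "Y = {t \<in> {pi * r..<2 * pi * r}. 0 \<le> k t}"
  have path: "circle_path x r t = x + r *\<^sub>R dir (t / r)" for t
    by (simp add: circle_path_def dir_def)
  \<comment> \<open>Antipodal points have opposite signs of \<open>k\<close>. So \<open>Y\<close>,
    from the second half of the circle, is as long as \<open>X'\<close>, and \<open>X\<close> with
    \<open>X'\<close> covers the first half.\<close>
  have kshift: "k (pi * r + t) = - k t" for t
    using r by (simp add: k_def cross2_def add_divide_distrib)
  have "continuous_on UNIV k"
    unfolding k_def by (intro continuous_intros continuous_on_compose2[OF continuous_on_dir[of UNIV]]) (use r in auto)
  then have k: "k \<in> borel_measurable borel" by (rule borel_measurable_continuous_onI)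
  have meas: "X \<in> sets borel" "X' \<in> sets borel" "Y \<in> sets borel"
    using k unfolding X_def X'_def Y_def by auto
  have "emeasure lborel Y = emeasure (distr lborel borel ((+) (pi * r))) Y"
    by (simp add: lborel_distr_plus)
  also have "\<dots> = emeasure lborel ((+) (pi * r) -` Y)"
    using meas by (subst emeasure_distr) auto
  also have "(+) (pi * r) -` Y = X'"
    by (auto simp: Y_def X'_def kshift)
  finally have Y: "emeasure lborel Y = emeasure lborel X'" .
  have "ennreal (pi * r) = emeasure lborel {0..<pi * r}" using r by simp
  also have "\<dots> \<le> emeasure lborel (X \<union> X')"
  proof (rule emeasure_mono)
    show "{0..<pi * r} \<subseteq> X \<union> X'" unfolding X_def X'_def using linear by blast
    show "X \<union> X' \<in> sets lborel" using meas by simp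
  qed
  also have "\<dots> \<le> emeasure lborel X + emeasure lborel X'"
    by (rule emeasure_subadditive) (use meas in simp_all)
  also have "\<dots> = emeasure lborel (X \<union> Y)"
    unfolding Y[symmetric] by (rule plus_emeasure) (use meas in \<open>auto simp: X_def Y_def\<close>)
  also have "X \<union> Y = {0..<2 * pi * r} \<inter> circle_path x r -` {s \<in> sphere x r. 0 \<le> cross2 w (s - x)}"
  proof -
    have "0 \<le> cross2 w (circle_path x r t - x) \<longleftrightarrow> 0 \<le> k t" for t
      using r by (simp add: path k_def zero_le_mult_iff)
    moreover have "pi * r \<le> 2 * pi * r" "0 \<le> pi * r" using r by auto
    ultimately show ?thesis
      using circle_path_in_sphere[OF r, of x] by (auto simp: X_def Y_def)
  qed
  also have "emeasure lborel \<dots> = emeasure (arclength x r) {s \<in> sphere x r. 0 \<le> cross2 w (s - x)}"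
  proof (rule emeasure_arclength[symmetric])
    have "closed {s. 0 \<le> cross2 w (s - x)}" by (intro closed_Collect_le continuous_intros)
    then have "closed (sphere x r \<inter> {s. 0 \<le> cross2 w (s - x)})" by (intro closed_Int) auto
    then show "{s \<in> sphere x r. 0 \<le> cross2 w (s - x)} \<in> sets borel" by (simp add: Int_def)
  qed
  finally show ?thesis .
qed

text \<open>The two half discs each contain at least half of the circle; on one of them
  \<open>u\<close> is at least \<open>u x\<close>, on the other at most \<open>u x\<close>.\<close>

lemma half_disc_property_circle_median:
  assumes u: "half_disc_property u x \<rho>" and neg: "half_disc_property (\<lambda>y. - u y) x \<rho>"
    and cont: "continuous_on (sphere x r) u" and r: "0 < r" "r < \<rho>"
  shows "circle_median x r u = u x"
proof (rule circle_median_eqI[OF r(1) cont])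
  obtain w where w: "\<And>y. y \<in> ball x \<rho> \<Longrightarrow> 0 \<le> cross2 w (y - x) \<Longrightarrow> u x \<le> u y"
    using u unfolding half_disc_property_def by blast
  obtain w' where w': "\<And>y. y \<in> ball x \<rho> \<Longrightarrow> 0 \<le> cross2 w' (y - x) \<Longrightarrow> u y \<le> u x"
    using neg unfolding half_disc_property_def neg_le_iff_le by blast
  have sub: "sphere x r \<subseteq> ball x \<rho>" using r by auto
  have sets: "sets (arclength x r) = sets borel" by (simp add: arclength_def)
  have half: "emeasure (arclength x r) (sphere x r) / 2 = ennreal (pi * r)"
    using r ennreal_divide_numeral[of "2 * pi * r" "num.Bit0 num.One"]
    by (simp add: emeasure_arclength_sphere)
  have "closed {s \<in> sphere x r. u s \<le> u x}"
    using continuous_closed_preimage[OF cont, of "{..u x}"] by (simp add: vimage_def Int_def)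
  then have m1: "{s \<in> sphere x r. u s \<le> u x} \<in> sets (arclength x r)" unfolding sets by (rule borel_closed)
  have "closed {s \<in> sphere x r. u s \<ge> u x}"
    using continuous_closed_preimage[OF cont, of "{u x..}"] by (simp add: vimage_def Int_def)
  then have m2: "{s \<in> sphere x r. u s \<ge> u x} \<in> sets (arclength x r)" unfolding sets by (rule borel_closed)
  have "{s \<in> sphere x r. 0 \<le> cross2 w (s - x)} \<subseteq> {s \<in> sphere x r. u s \<ge> u x}" using w sub by blast
  moreover have "{s \<in> sphere x r. 0 \<le> cross2 w' (s - x)} \<subseteq> {s \<in> sphere x r. u s \<le> u x}" using w' sub by blast
  ultimately show "is_median (arclength x r) (sphere x r) u (u x)"
    unfolding is_median_def half
    using emeasure_arclength_half_circle[OF r(1), of x w] emeasure_arclength_half_circle[OF r(1), of x w']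
      emeasure_mono[OF _ m1] emeasure_mono[OF _ m2] by (meson order_trans)
qed

text \<open>Transfers the property from the heights to their shifted and rescaled versions.\<close>

lemma half_disc_property_mono:
  assumes "half_disc_property u x r" "mono f"
  shows "half_disc_property (\<lambda>y. f (u y)) x r"
  using assms unfolding half_disc_property_def mono_def by metis

theorem theorem2:
  fixes \<Omega> :: "(real^2) set" and g :: "real^2 \<Rightarrow> real"
  assumes "open \<Omega>" and "bounded \<Omega>" and "strictly_convex \<Omega>" and "smooth_boundary \<Omega>"
    and "continuous_on (frontier \<Omega>) g"
    and "\<not> g constant_on frontier \<Omega>"
    and "\<And>c. finite (top_of_set (frontier \<Omega>) frontier_of {x \<in> frontier \<Omega>. g x = c})"
  shows "\<exists>u :: real^2 \<Rightarrow> real.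
           continuous_on (closure \<Omega>) u \<and>
           local_median_value_property \<Omega> u \<and>
           (\<forall>x\<in>frontier \<Omega>. u x = g x)"
proof -
  \<comment> \<open>On an empty frontier every function is constant. A nonempty frontier also makes
    \<Omega> nonempty, as the locale requires.\<close>
  have fr_ne: "frontier \<Omega> \<noteq> {}" using assms(6) by (auto simp: constant_on_def)
  then interpret strictly_convex_domain \<Omega>
    using assms by unfold_locales auto
  note g = assms(5)
  obtain \<gamma> where "boundary_curve \<Omega> \<gamma>" using ex_boundary_curve by blast
  from boundary_curve.ex_chord_family[OF this g]
  have "\<exists>A (p :: nat \<Rightarrow> real^2) q c. chord_family \<Omega> A p q \<and>
    (\<forall>s\<in>frontier \<Omega>. \<bar>(c + real (chord_family.height A p q s)) / Suc n - g s\<bar> \<le> 3 / Suc n)" for n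
    by (metis zero_less_Suc)
  then obtain A and p :: "nat \<Rightarrow> nat \<Rightarrow> real^2" and q c where fam: "\<And>n. chord_family \<Omega> (A n) (p n) (q n)"
    and approx: "\<And>n s. s \<in> frontier \<Omega> \<Longrightarrow>
      \<bar>(c n + real (chord_family.height (A n) (p n) (q n) s)) / Suc n - g s\<bar> \<le> 3 / Suc n"
    by metis
  define U where "U n x = (c n + real (chord_family.height (A n) (p n) (q n) x)) / Suc n" for n x
  have "bounded (g ` frontier \<Omega>)"
    by (intro compact_imp_bounded compact_continuous_image g compact_frontier)
  then obtain b where b: "\<And>s. s \<in> frontier \<Omega> \<Longrightarrow> \<bar>g s\<bar> \<le> b"
    by (auto simp: bounded_iff)
  have bd: "\<bar>U n x\<bar> \<le> b + 4" if "x \<in> closure \<Omega>" for n x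
    unfolding U_def by (rule chord_family.height_bounded[OF fam approx _ b that fr_ne]) auto
  have "uniformly_continuous_on (frontier \<Omega>) g"
    by (rule compact_uniformly_continuous[OF g compact_frontier])
  then have equi: "\<exists>d>0. \<forall>n. \<forall>x\<in>closure \<Omega>. \<forall>y\<in>closure \<Omega>. dist x y < d \<longrightarrow> \<bar>U n x - U n y\<bar> \<le> e + 8 / Suc n"
    if e: "e > 0" for e
  proof -
    obtain d' where d': "d' > 0" "\<And>s s'. s \<in> frontier \<Omega> \<Longrightarrow> s' \<in> frontier \<Omega> \<Longrightarrow> dist s s' < d' \<Longrightarrow> \<bar>g s - g s'\<bar> \<le> e"
      using \<open>uniformly_continuous_on (frontier \<Omega>) g\<close> e
      unfolding uniformly_continuous_on_def dist_real_def by (metis dist_commute less_imp_le abs_minus_commute)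
    show ?thesis
    proof (rule nearby_chords[OF d'(1)])
      fix d :: real
      assume d: "d > 0" and near: "\<And>p q p' q' z z'. \<lbrakk>p \<in> frontier \<Omega>; q \<in> frontier \<Omega>;
        p' \<in> frontier \<Omega>; q' \<in> frontier \<Omega>; z \<in> closed_segment p q; z' \<in> closed_segment p' q';
        dist z z' < d; dist p q + dist p' q' \<le> dist p q' + dist p' q\<rbrakk>
        \<Longrightarrow> dist p p' < d' \<or> dist q q' < d'"
      have "\<bar>U n x - U n y\<bar> \<le> e + 8 / Suc n" if "x \<in> closure \<Omega>" "y \<in> closure \<Omega>" "dist x y < d" for n x y
        unfolding U_def
        by (rule chord_family.height_equicontinuous[OF fam approx _ near d'(2) that]) (use e in auto)
      then show ?thesis using d by blast
    qed
  qed
  obtain k u where k: "strict_mono (k :: nat \<Rightarrow> nat)" and u: "continuous_on (closure \<Omega>) u"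
    and lim: "\<And>x. x \<in> closure \<Omega> \<Longrightarrow> (\<lambda>n. U (k n) x) \<longlonglongrightarrow> u x"
    using asymptotically_equicontinuous_subsequence[OF bd equi] by blast
  have ug: "u s = g s" if s: "s \<in> frontier \<Omega>" for s
  proof -
    have "(\<lambda>n. 3 / Suc n :: real) \<longlonglongrightarrow> 0" by (rule LIMSEQ_Suc[OF lim_const_over_n])
    from LIMSEQ_subseq_LIMSEQ[OF this k] have "(\<lambda>n. 3 / Suc (k n) :: real) \<longlonglongrightarrow> 0" by (simp add: o_def)
    then have "(\<lambda>n. U (k n) s - g s) \<longlonglongrightarrow> 0"
      by (rule Lim_null_comparison[rotated]) (use approx[OF s] in \<open>simp add: U_def\<close>)
    then have "(\<lambda>n. U (k n) s) \<longlonglongrightarrow> g s" by (simp add: LIM_zero_iff)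
    then show ?thesis using lim[OF frontier_closureD[OF s]] LIMSEQ_unique by blast
  qed
  \<comment> \<open>Half of the radius in \<open>sides_nested\<close>, so that the circle lies in
    the open ball.\<close>
  have med: "circle_median x r u = u x" if x: "x \<in> \<Omega>" and r: "0 < r" "r \<le> infdist x (frontier \<Omega>) / 20" for x r
  proof -
    define \<rho> where "\<rho> = infdist x (frontier \<Omega>) / 10"
    have \<rho>: "0 < r" "r < \<rho>" "0 < \<rho>" using r by (auto simp: \<rho>_def)
    have "ball x \<rho> \<subseteq> ball x (infdist x (frontier \<Omega>))" using \<rho> by (intro subset_ball) (simp add: \<rho>_def)
    then have sub: "ball x \<rho> \<subseteq> closure \<Omega>"
      using ball_infdist_frontier_subset[OF x] closure_subset[of \<Omega>] by blast
    have cont: "continuous_on (ball x \<rho>) u" using continuous_on_subset[OF u sub] .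
    have mono: "mono (\<lambda>t::real. (c n + t) / Suc n)" "mono (\<lambda>t::real. (t - c n) / Suc n)" for n
      by (auto simp: mono_def divide_right_mono)
    have 1: "half_disc_property (U n) x \<rho>" for n
      using half_disc_property_mono[OF chord_family.half_disc_property_height(1)[OF fam x \<rho>_def] mono(1)]
      unfolding U_def .
    have 2: "half_disc_property (\<lambda>y. - U n y) x \<rho>" for n
    proof -
      \<comment> \<open>This exhibits \<open>- U n\<close> as an increasing affine function of the
        negated height.\<close>
      have "- U n y = (- real (chord_family.height (A n) (p n) (q n) y) - c n) / Suc n" for y
        unfolding U_def minus_divide_left by simp
      then show ?thesis
        using half_disc_property_mono[OF chord_family.half_disc_property_height(2)[OF fam x \<rho>_def] mono(2)]
        by (simp only:)
    qed
    have "half_disc_property u x \<rho>"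
      by (rule half_disc_property_limit[where U = "\<lambda>n. U (k n)", OF 1]) (use lim sub cont \<rho> in auto)
    moreover have "half_disc_property (\<lambda>y. - u y) x \<rho>"
      by (rule half_disc_property_limit[where U = "\<lambda>n y. - U (k n) y", OF 2])
         (use lim sub cont \<rho> in \<open>auto intro!: tendsto_minus continuous_intros\<close>)
    moreover have "continuous_on (sphere x r) u"
      by (rule continuous_on_subset[OF cont]) (use \<rho> in auto)
    ultimately show ?thesis using half_disc_property_circle_median \<rho> by blast
  qed
  have "local_median_value_property \<Omega> u"
    unfolding local_median_value_property_def
  proof (intro conjI exI[of _ "\<lambda>x. infdist x (frontier \<Omega>) / 20"] ballI allI impI)
    show "continuous_on \<Omega> u" using continuous_on_subset[OF u closure_subset] .
    show "continuous_on \<Omega> (\<lambda>x. infdist x (frontier \<Omega>) / 20)" by (intro continuous_intros) auto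
    fix x assume x: "x \<in> \<Omega>"
    then have "x \<notin> frontier \<Omega>" using frontier_notin by blast
    then have "0 < infdist x (frontier \<Omega>)"
      by (intro infdist_pos_not_in_closed) (use fr_ne in auto)
    then show "0 < infdist x (frontier \<Omega>) / 20" "infdist x (frontier \<Omega>) / 20 \<le> infdist x (frontier \<Omega>)" by auto
    fix r assume "0 < r \<and> r \<le> infdist x (frontier \<Omega>) / 20"
    then show "u x = circle_median x r u" using med[OF x] by simp
  qed
  then show ?thesis using u ug by blast
qed

end
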